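(* Consider the bit-commitment based coin-flipping protocol parameterized by $\alpha_0,\alpha_1\in\mathrm{Prob}^A$ and $\beta_0,\beta_1\in\mathrm{Prob}^B$, where $A=A_1\times\cdots\times A_n$, $B=B_1\times\cdots\times B_n$, $n\ge1$. Then \begin{align*} P_{\mathrm A,0}^* &\ \ge\ \frac12\sum_{y\in B}\mathrm{conc}\left\{\beta_{a,y}\,\mathrm F(\cdot,\alpha_a): a\in\{0,1\}\right\}(v)\\ &\ \ge\ \frac12\,\lambda_{\max}\left(\eta\sqrt{\alpha_0}\sqrt{\alpha_0}^{\mathrm T}+\tau\sqrt{\alpha_1}\sqrt{\alpha_1}^{\mathrm T}\right)\\ &\ \ge\ \left(\frac12+\frac12\sqrt{\mathrm F(\alpha_0,\alpha_1)}\right)\left(\frac12+\frac12\Delta(\beta_0,\beta_1)\right), \end{align*} where $$\eta=\sum_{y\in B:\ \beta_{0,y}\ge\beta_{1,y}}\beta_{0,y},\qquad \tau=\sum_{y\in B:\ \beta_{0,y}<\beta_{1,y}}\beta_{1,y},$$ and $\sqrt v$ is the normalized principal eigenvector of $\eta\sqrt{\alpha_0}\sqrt{\alpha_0}^{\mathrm T}+\tau\sqrt{\alpha_1}\sqrt{\alpha_1}^{\mathrm T}$. Furthermore, in a six-round protocol (i.e. $n=2$), \begin{align*} P_{\mathrm A,0}^* &\ \ge\ \frac12\,\lambda_{\max}\left(\eta'\sqrt{\mathrm{Tr}_{A_2}(\alpha_0)}\sqrt{\mathrm{Tr}_{A_2}(\alpha_0)}^{\mathrm T}+\tau'\sqrt{\mathrm{Tr}_{A_2}(\alpha_1)}\sqrt{\mathrm{Tr}_{A_2}(\alpha_1)}^{\mathrm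 T}\right)\\ &\ \ge\ \left(\frac12+\frac12\sqrt{\mathrm F(\mathrm{Tr}_{A_2}(\alpha_0),\mathrm{Tr}_{A_2}(\alpha_1))}\right)\left(\frac12+\frac12\Delta(\mathrm{Tr}_{B_2}(\beta_0),\mathrm{Tr}_{B_2}(\beta_1))\right), \end{align*} where $$\eta'=\sum_{\substack{y_1\in B_1:\\ [\mathrm{Tr}_{B_2}(\beta_0)]_{y_1}\ge[\mathrm{Tr}_{B_2}(\beta_1)]_{y_1}}}[\mathrm{Tr}_{B_2}(\beta_0)]_{y_1},\qquad \tau'=\sum_{\substack{y_1\in B_1:\\ [\mathrm{Tr}_{B_2}(\beta_0)]_{y_1}<[\mathrm{Tr}_{B_2}(\beta_1)]_{y_1}}}[\mathrm{Tr}_{B_2}(\beta_1)]_{y_1}.$$ Analogous bounds hold for $P_{\mathrm A,1}^*$, with $\beta_0$ and $\beta_1$ interchanged. Namely, for every $n\ge1$, \begin{align*} P_{\mathrm A,1}^* &\ \ge\ \frac12\sum_{y\in B}\mathrm{conc}\left\{\beta_{a\oplus1,y}\,\mathrm F(\cdot,\alpha_a): a\in\{0,1\}\right\}(\hat v)\\ &\ \ge\ \frac12\,\lambda_{\max}\left(\hat\eta\sqrt{\alpha_0}\sqrt{\alpha_0}^{\mathrm T}+\hat\tau\sqrt{\alpha_1}\sqrt{\alpha_1}^{\mathrm T}\right)\\ &\ \ge\ \left(\frac12+\frac12\sqrt{\mathrm F(\alpha_0,\alpha_1)}\right)\left(\frac12+\frac12\Delta(\beta_0,\beta_1)\right), \end{align*}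 where $$\hat\eta=\sum_{y\in B:\ \beta_{1,y}\ge\beta_{0,y}}\beta_{1,y},\qquad \hat\tau=\sum_{y\in B:\ \beta_{1,y}<\beta_{0,y}}\beta_{0,y},$$ and $\sqrt{\hat v}$ is the normalized principal eigenvector of $\hat\eta\sqrt{\alpha_0}\sqrt{\alpha_0}^{\mathrm T}+\hat\tau\sqrt{\alpha_1}\sqrt{\alpha_1}^{\mathrm T}$; and in a six-round protocol (i.e. $n=2$), \begin{align*} P_{\mathrm A,1}^* &\ \ge\ \frac12\,\lambda_{\max}\left(\hat\eta'\sqrt{\mathrm{Tr}_{A_2}(\alpha_0)}\sqrt{\mathrm{Tr}_{A_2}(\alpha_0)}^{\mathrm T}+\hat\tau'\sqrt{\mathrm{Tr}_{A_2}(\alpha_1)}\sqrt{\mathrm{Tr}_{A_2}(\alpha_1)}^{\mathrm T}\right)\\ &\ \ge\ \left(\frac12+\frac12\sqrt{\mathrm F(\mathrm{Tr}_{A_2}(\alpha_0),\mathrm{Tr}_{A_2}(\alpha_1))}\right)\left(\frac12+\frac12\Delta(\mathrm{Tr}_{B_2}(\beta_0),\mathrm{Tr}_{B_2}(\beta_1))\right), \end{align*} where $$\hat\eta'=\sum_{\substack{y_1\in B_1:\\ [\mathrm{Tr}_{B_2}(\beta_1)]_{y_1}\ge[\mathrm{Tr}_{B_2}(\beta_0)]_{y_1}}}[\mathrm{Tr}_{B_2}(\beta_1)]_{y_1},\qquad \hat\tau'=\sum_{\substack{y_1\in B_1:\\ [\mathrm{Tr}_{B_2}(\beta_1)]_{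y_1}<[\mathrm{Tr}_{B_2}(\beta_0)]_{y_1}}}[\mathrm{Tr}_{B_2}(\beta_0)]_{y_1}.$$
   Context: Notation. For a finite set $S$: $\mathbb{R}_+^S$ is the set of nonnegative real vectors indexed by $S$; $\mathrm{Prob}^S$ is the set of probability vectors indexed by $S$; $e_x$ ($x\in S$) are the standard basis vectors. $\oplus$ is XOR of bits. For a nonnegative vector $x$, $\sqrt x$ is the entrywise square root; a principal eigenvector is an eigenvector for the largest eigenvalue $\lambda_{\max}$, normalized in Euclidean norm and here taken entrywise nonnegative, so $v$ (and likewise $\hat v$) is its entrywise square. For $p,q\in\mathbb{R}_+^S$, $\mathrm{F}(p,q)=\left(\sum_{x\in S}\sqrt{p_x}\sqrt{q_x}\right)^2$. $\Delta(p,q)=\frac12\|p-q\|_1$. For $v\in\mathbb{R}^{S\times T}$, $\mathrm{Tr}_S(v)\in\mathbb{R}^T$ is given by $[\mathrm{Tr}_S(v)]_t=\sum_{s\in S}v_{s,t}$. $\mathrm{conc}\{f_1,f_2\}$ is the concave hull: the least concave function $f$ with $f\ge f_1$ and $f\ge f_2$ pointwise; here $\mathrm F(\cdot,\alpha)$ is regarded as a concave function on $\mathbb{R}^A$ with value $-\infty$ outside $\mathbb{R}_+^A$. Protocol. Let $A_i,B_i$ be finite sets, let $A'=A$ and $B'=B$ be copies, and $A_0=A_0'=B_0=B_0'=\{0,1\}$; a set is used as a label for the quantum register with state space $\mathbb{C}^{\text{set}}$. Put $\psi_a=\sum_{x\in A}\sqrt{\alpha_{a,x}}\,e_x\otimes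 e_x\in\mathbb{C}^A\otimes\mathbb{C}^{A'}$, $\psi=\sum_{a\in\{0,1\}}\frac{1}{\sqrt2}e_a\otimes e_a\otimes\psi_a\in\mathbb{C}^{A_0}\otimes\mathbb{C}^{A_0'}\otimes\mathbb{C}^A\otimes\mathbb{C}^{A'}$, $\phi_b=\sum_{y\in B}\sqrt{\beta_{b,y}}\,e_y\otimes e_y\in\mathbb{C}^B\otimes\mathbb{C}^{B'}$, $\phi=\sum_{b\in\{0,1\}}\frac{1}{\sqrt2}e_b\otimes e_b\otimes\phi_b\in\mathbb{C}^{B_0}\otimes\mathbb{C}^{B_0'}\otimes\mathbb{C}^B\otimes\mathbb{C}^{B'}$. Alice prepares $\psi$ and Bob prepares $\phi$. For $i=1,\ldots,n$: Alice sends $\mathbb{C}^{A_i}$ to Bob, who replies with $\mathbb{C}^{B_i}$. Then Alice sends $\mathbb{C}^{A_0'}$ and $\mathbb{C}^{A'}$ to Bob, and then Bob sends $\mathbb{C}^{B_0'}$ and $\mathbb{C}^{B'}$ to Alice (so there are $2n+2$ rounds). Finally Alice measures registers $A_0,B_0',B,B'$ with the POVM $(\Pi_{\mathrm A,0},\Pi_{\mathrm A,1},\Pi_{\mathrm A,\mathrm{abort}})$, where $\Pi_{\mathrm A,c}=\sum_{b\in\{0,1\}}e_{b\oplus c}e_{b\oplus c}^*\otimes e_be_b^*\otimes\phi_b\phi_b^*$ and $\Pi_{\mathrm A,\mathrm{abort}}=\mathrm I-\Pi_{\mathrm A,0}-\Pi_{\mathrm A,1}$; Bob measures registers $B_0,A_0',A,A'$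 with $(\Pi_{\mathrm B,0},\Pi_{\mathrm B,1},\Pi_{\mathrm B,\mathrm{abort}})$, where $\Pi_{\mathrm B,c}=\sum_{a\in\{0,1\}}e_{a\oplus c}e_{a\oplus c}^*\otimes e_ae_a^*\otimes\psi_a\psi_a^*$ and $\Pi_{\mathrm B,\mathrm{abort}}=\mathrm I-\Pi_{\mathrm B,0}-\Pi_{\mathrm B,1}$. The measurement outcome is the party's output. Cheating. A cheating party may use a private workspace of arbitrary finite dimension, an arbitrary initial state (unentangled with the honest party), arbitrary quantum operations on the qubits in its possession between messages, and an arbitrary final measurement; the only restriction is that its messages have the dimensions prescribed by the protocol. The other party follows the protocol. $P_{\mathrm A,c}^*$ is the supremum, over all cheating strategies of Alice, of the probability that honest Bob outputs $c$. *)

theory Defs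
  imports "HOL-Analysis.Analysis" "HOL-Library.Z2"
begin

text \<open>
  Vectors and matrices indexed by a finite set \<open>S\<close> are functions on the ambient type together
  with the explicit carrier \<open>S\<close>; their values off \<open>S\<close> are irrelevant. The product
  \<open>A\<^sub>1 \<times> \<dots> \<times> A\<^sub>n\<close> is \<open>Pi\<^sub>E {1..n} A\<close>. Bits are elements of the two-element field
  \<^typ>\<open>bit\<close>, so that XOR is addition.
\<close>

definition prob_vec :: "'s set \<Rightarrow> ('s \<Rightarrow> real) \<Rightarrow> bool" where
  "prob_vec S p \<longleftrightarrow> (\<forall>x\<in>S. 0 \<le> p x) \<and> sum p S = 1"

definition fidelity :: "'s set \<Rightarrow> ('s \<Rightarrow> real) \<Rightarrow> ('s \<Rightarrow> real) \<Rightarrow> real" where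
  "fidelity S p q = (\<Sum>x\<in>S. sqrt (p x) * sqrt (q x))\<^sup>2"

definition trace_dist :: "'s set \<Rightarrow> ('s \<Rightarrow> real) \<Rightarrow> ('s \<Rightarrow> real) \<Rightarrow> real" where
  "trace_dist S p q = 1 / 2 * (\<Sum>x\<in>S. \<bar>p x - q x\<bar>)"

definition eigenvector_on ::
    "'s set \<Rightarrow> ('s \<Rightarrow> 's \<Rightarrow> real) \<Rightarrow> real \<Rightarrow> ('s \<Rightarrow> real) \<Rightarrow> bool" where
  "eigenvector_on S M \<mu> x \<longleftrightarrow>
     (\<exists>s\<in>S. x s \<noteq> 0) \<and> (\<forall>s\<in>S. (\<Sum>t\<in>S. M s t * x t) = \<mu> * x s)"

definition lambda_max :: "'s set \<Rightarrow> ('s \<Rightarrow> 's \<Rightarrow> real) \<Rightarrow> real" where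
  "lambda_max S M = (GREATEST \<mu>. \<exists>x. eigenvector_on S M \<mu> x)"

definition principal_eigenvector ::
    "'s set \<Rightarrow> ('s \<Rightarrow> 's \<Rightarrow> real) \<Rightarrow> ('s \<Rightarrow> real) \<Rightarrow> bool" where
  "principal_eigenvector S M x \<longleftrightarrow>
     eigenvector_on S M (lambda_max S M) x \<and> (\<Sum>s\<in>S. (x s)\<^sup>2) = 1 \<and> (\<forall>s\<in>S. 0 \<le> x s)"

definition outer :: "('s \<Rightarrow> real) \<Rightarrow> 's \<Rightarrow> 's \<Rightarrow> real" where
  "outer u s t = u s * u t"

definition sqrt_matrix ::
    "real \<Rightarrow> ('s \<Rightarrow> real) \<Rightarrow> real \<Rightarrow> ('s \<Rightarrow> real) \<Rightarrow> 's \<Rightarrow> 's \<Rightarrow> real" where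
  "sqrt_matrix e p f q s t =
     e * outer (\<lambda>x. sqrt (p x)) s t + f * outer (\<lambda>x. sqrt (q x)) s t"

definition eta :: "'s set \<Rightarrow> ('s \<Rightarrow> real) \<Rightarrow> ('s \<Rightarrow> real) \<Rightarrow> real" where
  "eta S p q = (\<Sum>y\<in>{y\<in>S. p y \<ge> q y}. p y)"

definition tau :: "'s set \<Rightarrow> ('s \<Rightarrow> real) \<Rightarrow> ('s \<Rightarrow> real) \<Rightarrow> real" where
  "tau S p q = (\<Sum>y\<in>{y\<in>S. p y < q y}. q y)"

text \<open>For \<open>v\<close> indexed by \<open>S\<^sub>1 \<times> S\<^sub>2 = Pi\<^sub>E {1..2} S\<close>, the partial trace over \<open>S\<^sub>2\<close>.\<close>

definition trace2 :: "(nat \<Rightarrow> 's set) \<Rightarrow> ((nat \<Rightarrow> 's) \<Rightarrow> real) \<Rightarrow> 's \<Rightarrow> real" where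
  "trace2 S v s1 = (\<Sum>s2\<in>S 2. v (\<lambda>k\<in>{1..2}. if k = 1 then s1 else s2))"

text \<open>Concavity is convexity of the hypograph, which avoids \<open>\<infinity> - \<infinity>\<close>.\<close>

definition concave_ext :: "(('s \<Rightarrow> real) \<Rightarrow> ereal) \<Rightarrow> bool" where
  "concave_ext f \<longleftrightarrow>
     (\<forall>u w r q t. 0 \<le> t \<and> t \<le> 1 \<and> ereal r \<le> f u \<and> ereal q \<le> f w \<longrightarrow>
        ereal ((1 - t) * r + t * q) \<le> f (\<lambda>s. (1 - t) * u s + t * w s))"

definition conc :: "(('s \<Rightarrow> real) \<Rightarrow> ereal) set \<Rightarrow> ('s \<Rightarrow> real) \<Rightarrow> ereal" where
  "conc G = (LEAST f. concave_ext f \<and> (\<forall>g\<in>G. g \<le> f))"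

text \<open>
  The function \<open>c F(\<cdot>, q)\<close>, for \<open>c \<ge> 0\<close>. It is \<open>-\<infinity>\<close> outside the nonnegative orthant also when
  \<open>c = 0\<close>; multiplying by \<open>c\<close> in \<^typ>\<open>ereal\<close> would give \<open>0\<close> there.
\<close>

definition scaled_fid :: "'s set \<Rightarrow> real \<Rightarrow> ('s \<Rightarrow> real) \<Rightarrow> ('s \<Rightarrow> real) \<Rightarrow> ereal" where
  "scaled_fid S c q p = (if \<forall>x\<in>S. 0 \<le> p x then ereal (c * fidelity S p q) else -\<infinity>)"

type_synonym 's cmat = "'s \<Rightarrow> 's \<Rightarrow> complex"

definition psd_on :: "'s set \<Rightarrow> 's cmat \<Rightarrow> bool" where
  "psd_on S M \<longleftrightarrow> (\<forall>f. (\<Sum>s\<in>S. \<Sum>t\<in>S. cnj (f s) * M s t * f t) \<in> \<real>\<^sub>\<ge>\<^sub>0)"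

definition trace_on :: "'s set \<Rightarrow> 's cmat \<Rightarrow> complex" where
  "trace_on S M = (\<Sum>s\<in>S. M s s)"

definition density_on :: "'s set \<Rightarrow> 's cmat \<Rightarrow> bool" where
  "density_on S \<rho> \<longleftrightarrow> psd_on S \<rho> \<and> trace_on S \<rho> = 1"

definition tensor_id :: "('s cmat \<Rightarrow> 's cmat) \<Rightarrow> ('s \<times> 'r) cmat \<Rightarrow> ('s \<times> 'r) cmat" where
  "tensor_id \<Phi> M = (\<lambda>(s, j) (t, l). \<Phi> (\<lambda>s' t'. M (s', j) (t', l)) s t)"

text \<open>
  Completely positive trace-preserving linear maps on the \<open>S \<times> S\<close> matrices. The first condition
  says that the map is well defined on such matrices, i.e. ignores entries off \<open>S \<times> S\<close>.
\<close>

definition quantum_op_on :: "'s set \<Rightarrow> ('s cmat \<Rightarrow> 's cmat) \<Rightarrow> bool" where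
  "quantum_op_on S \<Phi> \<longleftrightarrow>
     (\<forall>M N. (\<forall>s\<in>S. \<forall>t\<in>S. M s t = N s t) \<longrightarrow> (\<forall>s\<in>S. \<forall>t\<in>S. \<Phi> M s t = \<Phi> N s t)) \<and>
     (\<forall>M N. \<forall>s\<in>S. \<forall>t\<in>S. \<Phi> (\<lambda>s t. M s t + N s t) s t = \<Phi> M s t + \<Phi> N s t) \<and>
     (\<forall>c M. \<forall>s\<in>S. \<forall>t\<in>S. \<Phi> (\<lambda>s t. c * M s t) s t = c * \<Phi> M s t) \<and>
     (\<forall>M. trace_on S (\<Phi> M) = trace_on S M) \<and>
     (\<forall>k::nat. \<forall>M. psd_on (S \<times> {..<k}) M \<longrightarrow> psd_on (S \<times> {..<k}) (tensor_id \<Phi> M))"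

text \<open>
  The basis states of all registers together are the tuples
  \<open>((w, a0', x'), x, y, (b0, b0', y'))\<close>, with one entry for each of the registers \<open>W\<close> (Alice's
  workspace, of dimension \<open>d\<close>), \<open>A\<^sub>0'\<close>, \<open>A'\<close>, \<open>A\<close>, \<open>B\<close>, \<open>B\<^sub>0\<close>, \<open>B\<^sub>0'\<close>, \<open>B'\<close>. (The honest party's
  \<open>A\<^sub>0\<close> is never sent; a cheating Alice has it as part of \<open>W\<close>.) Sending a register only changes
  who possesses it.
\<close>

type_synonym ('a, 'b) basis =
  "(nat \<times> bit \<times> (nat \<Rightarrow> 'a)) \<times> (nat \<Rightarrow> 'a) \<times> (nat \<Rightarrow> 'b) \<times> (bit \<times> bit \<times> (nat \<Rightarrow> 'b))"

type_synonym ('a, 'b) alice_basis =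
  "(nat \<times> bit \<times> (nat \<Rightarrow> 'a)) \<times> (nat \<Rightarrow> 'a) \<times> (nat \<Rightarrow> 'b)"

definition basis_set ::
    "nat \<Rightarrow> (nat \<Rightarrow> 'a set) \<Rightarrow> (nat \<Rightarrow> 'b set) \<Rightarrow> nat \<Rightarrow> ('a, 'b) basis set" where
  "basis_set n A B d =
     ({..<d} \<times> {0, 1} \<times> Pi\<^sub>E {1..n} A) \<times> Pi\<^sub>E {1..n} A \<times> Pi\<^sub>E {1..n} B \<times>
     ({0, 1} \<times> {0, 1} \<times> Pi\<^sub>E {1..n} B)"

text \<open>
  Just before her \<open>i\<close>-th message, Alice possesses \<open>W, A\<^sub>0', A'\<close>, the registers \<open>A\<^sub>i, \<dots>, A\<^sub>n\<close> not
  yet sent, and the registers \<open>B\<^sub>1, \<dots>, B\<^bsub>i-1\<^esub>\<close> received. Message \<open>i \<le> n\<close> is \<open>A\<^sub>i\<close>; message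
  \<open>n + 1\<close> is \<open>A\<^sub>0'\<close> together with \<open>A'\<close>.
\<close>

definition alice_set ::
    "nat \<Rightarrow> (nat \<Rightarrow> 'a set) \<Rightarrow> (nat \<Rightarrow> 'b set) \<Rightarrow> nat \<Rightarrow> nat \<Rightarrow> ('a, 'b) alice_basis set" where
  "alice_set n A B d i =
     ({..<d} \<times> {0, 1} \<times> Pi\<^sub>E {1..n} A) \<times> Pi\<^sub>E {i..n} A \<times> Pi\<^sub>E {1..<i} B"

fun alice_part :: "nat \<Rightarrow> nat \<Rightarrow> ('a, 'b) basis \<Rightarrow> ('a, 'b) alice_basis" where
  "alice_part n i (p, x, y, r) = (p, restrict x {i..n}, restrict y {1..<i})"

fun set_alice_part ::
    "nat \<Rightarrow> nat \<Rightarrow> ('a, 'b) alice_basis \<Rightarrow> ('a, 'b) basis \<Rightarrow> ('a, 'b) basis" where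
  "set_alice_part n i (p', x', y') (p, x, y, r) =
     (p', override_on x x' {i..n}, override_on y y' {1..<i}, r)"

text \<open>\<open>\<Phi>\<close> acts on the registers in Alice's possession, the identity on all others.\<close>

definition apply_alice ::
    "nat \<Rightarrow> nat \<Rightarrow> (('a, 'b) alice_basis cmat \<Rightarrow> ('a, 'b) alice_basis cmat) \<Rightarrow>
     ('a, 'b) basis cmat \<Rightarrow> ('a, 'b) basis cmat" where
  "apply_alice n i \<Phi> \<rho> g h =
     \<Phi> (\<lambda>s t. \<rho> (set_alice_part n i s g) (set_alice_part n i t h)) (alice_part n i g) (alice_part n i h)"

text \<open>The vectors \<open>\<psi>\<^sub>a\<close>, \<open>\<phi>\<^sub>b\<close> (both of the form \<open>\<Sum>x. \<surd>(p x) e\<^sub>x \<otimes> e\<^sub>x\<close>) and \<open>\<phi>\<close> in coordinates.\<close>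

definition pair_state :: "('s \<Rightarrow> real) \<Rightarrow> 's \<Rightarrow> 's \<Rightarrow> complex" where
  "pair_state p x x' = (if x = x' then complex_of_real (sqrt (p x)) else 0)"

fun phi_state ::
    "(bit \<Rightarrow> (nat \<Rightarrow> 'b) \<Rightarrow> real) \<Rightarrow> bit \<times> bit \<times> (nat \<Rightarrow> 'b) \<times> (nat \<Rightarrow> 'b) \<Rightarrow> complex" where
  "phi_state \<beta> (b0, b0', y, y') =
     (if b0 = b0' then complex_of_real (1 / sqrt 2) * pair_state (\<beta> b0) y y' else 0)"

fun bob_start :: "('a, 'b) basis \<Rightarrow> bit \<times> bit \<times> (nat \<Rightarrow> 'b) \<times> (nat \<Rightarrow> 'b)" where
  "bob_start (p, x, y, (b0, b0', y')) = (b0, b0', y, y')"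

text \<open>\<open>\<sigma> \<otimes> \<phi> \<phi>\<^sup>*\<close>, where \<open>\<sigma>\<close> is Alice's initial state.\<close>

definition initial_state ::
    "nat \<Rightarrow> (bit \<Rightarrow> (nat \<Rightarrow> 'b) \<Rightarrow> real) \<Rightarrow> ('a, 'b) alice_basis cmat \<Rightarrow> ('a, 'b) basis cmat" where
  "initial_state n \<beta> \<sigma> g h =
     \<sigma> (alice_part n 1 g) (alice_part n 1 h) *
     (phi_state \<beta> (bob_start g) * cnj (phi_state \<beta> (bob_start h)))"

primrec run ::
    "nat \<Rightarrow> (bit \<Rightarrow> (nat \<Rightarrow> 'b) \<Rightarrow> real) \<Rightarrow> ('a, 'b) alice_basis cmat \<Rightarrow>
     (nat \<Rightarrow> ('a, 'b) alice_basis cmat \<Rightarrow> ('a, 'b) alice_basis cmat) \<Rightarrow> nat \<Rightarrow>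
     ('a, 'b) basis cmat" where
  "run n \<beta> \<sigma> \<Phi> 0 = initial_state n \<beta> \<sigma>"
| "run n \<beta> \<sigma> \<Phi> (Suc i) = apply_alice n (Suc i) (\<Phi> (Suc i)) (run n \<beta> \<sigma> \<Phi> i)"

text \<open>\<open>\<Pi>\<^bsub>B,c\<^esub>\<close>, on the registers \<open>B\<^sub>0, A\<^sub>0', A, A'\<close> in this order.\<close>

fun bob_povm ::
    "(bit \<Rightarrow> (nat \<Rightarrow> 'a) \<Rightarrow> real) \<Rightarrow> bit \<Rightarrow> (bit \<times> bit \<times> (nat \<Rightarrow> 'a) \<times> (nat \<Rightarrow> 'a)) cmat" where
  "bob_povm \<alpha> c (b, a, x, x') (b2, a2, z, z') =
     (\<Sum>k\<in>{0, 1}. of_bool (b = k + c \<and> b2 = k + c) * of_bool (a = k \<and> a2 = k) *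
        (pair_state (\<alpha> k) x x' * cnj (pair_state (\<alpha> k) z z')))"

text \<open>\<open>\<Pi>\<^bsub>B,c\<^esub>\<close> tensored with the identity on \<open>W, B, B\<^sub>0', B'\<close>.\<close>

fun bob_measure ::
    "(bit \<Rightarrow> (nat \<Rightarrow> 'a) \<Rightarrow> real) \<Rightarrow> bit \<Rightarrow> ('a, 'b) basis cmat" where
  "bob_measure \<alpha> c ((w, a, x'), x, y, (b, b', y')) ((w2, a2, z'), z, y2, (b2, b2', y2')) =
     of_bool (w = w2 \<and> y = y2 \<and> b' = b2' \<and> y' = y2') *
     bob_povm \<alpha> c (b, a, x, x') (b2, a2, z, z')"

text \<open>The probability that Bob outputs \<open>c\<close>, i.e. the trace of \<open>\<Pi>\<^bsub>B,c\<^esub>\<close> times the final state.\<close>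

definition bob_prob ::
    "nat \<Rightarrow> (nat \<Rightarrow> 'a set) \<Rightarrow> (nat \<Rightarrow> 'b set) \<Rightarrow> (bit \<Rightarrow> (nat \<Rightarrow> 'a) \<Rightarrow> real) \<Rightarrow>
     (bit \<Rightarrow> (nat \<Rightarrow> 'b) \<Rightarrow> real) \<Rightarrow> bit \<Rightarrow> nat \<Rightarrow> ('a, 'b) alice_basis cmat \<Rightarrow>
     (nat \<Rightarrow> ('a, 'b) alice_basis cmat \<Rightarrow> ('a, 'b) alice_basis cmat) \<Rightarrow> real" where
  "bob_prob n A B \<alpha> \<beta> c d \<sigma> \<Phi> =
     Re (\<Sum>g\<in>basis_set n A B d. \<Sum>h\<in>basis_set n A B d.
           bob_measure \<alpha> c g h * run n \<beta> \<sigma> \<Phi> (n + 1) h g)"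

text \<open>
  A strategy consists of a workspace dimension, an initial state, and an operation before each
  of Alice's \<open>n + 1\<close> messages. Whatever she does after her last message, including her final
  measurement, acts on registers that Bob no longer touches, hence does not occur in the
  probability of his output.
\<close>

definition P_cheat_alice ::
    "nat \<Rightarrow> (nat \<Rightarrow> 'a set) \<Rightarrow> (nat \<Rightarrow> 'b set) \<Rightarrow> (bit \<Rightarrow> (nat \<Rightarrow> 'a) \<Rightarrow> real) \<Rightarrow>
     (bit \<Rightarrow> (nat \<Rightarrow> 'b) \<Rightarrow> real) \<Rightarrow> bit \<Rightarrow> real" where
  "P_cheat_alice n A B \<alpha> \<beta> c =
     Sup {bob_prob n A B \<alpha> \<beta> c d \<sigma> \<Phi> | d \<sigma> \<Phi>.
            density_on (alice_set n A B d 1) \<sigma> \<and>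
            (\<forall>i\<in>{1..n + 1}. quantum_op_on (alice_set n A B d i) (\<Phi> i))}"

end

theory Submission
  imports Defs
begin

text \<open>
  Every bound on the cheating probability comes from one kind of strategy, analysed in
  \<open>single_op_strategy\<close>. Alice starts with a superposition, with distribution \<open>v\<close>, of the components
  that she sends in her first messages, keeping a coherent copy. At one point of the protocol she
  uses the part of \<open>y\<close> that she has received to prepare, coherently and conditionally on it, the
  bit \<open>a\<close> to which she is going to open and the components still to be sent. All registers remain in
  a pure state, in which the pair \<open>(a, x)\<close> has some distribution \<open>s\<^bsub>a,y\<^esub>(x)\<close> given \<open>y\<close>, and Bob's
  test succeeds with probability \<open>1/2 \<Sum>a y. \<beta>\<^bsub>a+c,y\<^esub> F(s\<^bsub>a,y\<^esub>, \<alpha>\<^sub>a)\<close>.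

  If she waits until she knows all of \<open>y\<close>, the two vectors \<open>s\<^bsub>0,y\<^esub>\<close> and \<open>s\<^bsub>1,y\<^esub>\<close> can be any nonnegative
  vectors with sum \<open>v\<close>. Since the fidelity is concave and homogeneous of degree one, the supremum
  over such splittings is a concave function of \<open>v\<close>, so it is at least the concave hull
  (\<open>conc_le_best_split\<close>); this gives the first inequality. Using, for each \<open>y\<close>, only the function with
  the larger coefficient bounds the sum of the hulls below by \<open>\<eta> F(v, \<alpha>\<^sub>0) + \<tau> F(v, \<alpha>\<^sub>1)\<close>
  (\<open>sum_conc_ge\<close>), which is the value of the quadratic form \<open>\<eta> \<surd>\<alpha>\<^sub>0 \<surd>\<alpha>\<^sub>0\<^sup>T + \<tau> \<surd>\<alpha>\<^sub>1 \<surd>\<alpha>\<^sub>1\<^sup>T\<close> at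
  \<open>\<surd>v\<close>. For the principal eigenvector this is the largest eigenvalue. With two exchanges, deciding
  already after \<open>y\<^sub>1\<close> and completing \<open>x\<close> from the honest conditional distribution gives the same
  expression for the marginals (\<open>P_cheat_alice_ge_two\<close>).

  The matrix has rank at most two, so its largest eigenvalue is the larger root of a quadratic equation
  in \<open>\<eta>\<close>, \<open>\<tau>\<close> and the inner product of \<open>\<surd>\<alpha>\<^sub>0\<close> and \<open>\<surd>\<alpha>\<^sub>1\<close>; this yields the existence of a
  nonnegative principal eigenvector, and the last inequality by \<open>\<eta> + \<tau> = 1 + \<Delta>(\<beta>\<^sub>0, \<beta>\<^sub>1)\<close>.

  The cheating probability being a supremum of real numbers, the value of a strategy is a lower
  bound for it only if the values of all strategies are bounded. This holds because the state of a run
  remains a density matrix (\<open>run_density\<close>), and the row sums of Bob's measurement operator are bounded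
  uniformly in the dimension of Alice's workspace.
\<close>

section \<open>The largest eigenvalue of a combination of two rank-one matrices\<close>

text \<open>
  The sum is the inner product of the unit vectors \<open>\<surd>p\<close> and \<open>\<surd>q\<close>; termwise, the geometric mean is
  at most the arithmetic mean.
\<close>

lemma affinity_le_one:
  assumes "prob_vec S p" "prob_vec S q"
  shows "(\<Sum>x\<in>S. sqrt (p x) * sqrt (q x)) \<le> 1"
proof -
  have "(\<Sum>x\<in>S. sqrt (p x) * sqrt (q x)) \<le> (\<Sum>x\<in>S. (p x + q x) / 2)"
  proof (rule sum_mono)
    fix x assume "x \<in> S"
    then have "0 \<le> p x" "0 \<le> q x" using assms by (auto simp: prob_vec_def)
    then show "sqrt (p x) * sqrt (q x) \<le> (p x + q x) / 2"
      using arith_geo_mean_sqrt by (simp add: real_sqrt_mult)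
  qed
  also have "\<dots> = 1"
    using assms by (simp add: prob_vec_def sum.distrib flip: sum_divide_distrib)
  finally show ?thesis .
qed

lemma sqrt_matrix_apply:
  "(\<Sum>t\<in>S. sqrt_matrix e p f q s t * x t) =
     e * (\<Sum>t\<in>S. sqrt (p t) * x t) * sqrt (p s) + f * (\<Sum>t\<in>S. sqrt (q t) * x t) * sqrt (q s)"
  by (simp add: sqrt_matrix_def outer_def sum_distrib_left sum_distrib_right sum.distrib algebra_simps)

text \<open>
  The larger root of \<open>(t - e) (t - f) = e f c\<^sup>2\<close>, the characteristic equation of
  \<open>e u u\<^sup>T + f w w\<^sup>T\<close> on the span of two unit vectors \<open>u\<close>, \<open>w\<close> with inner product \<open>c\<close>.
\<close>

definition top_root :: "real \<Rightarrow> real \<Rightarrow> real \<Rightarrow> real" where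
  "top_root e f c = ((e + f) + sqrt ((e - f)\<^sup>2 + 4 * e * f * c\<^sup>2)) / 2"

lemma top_root_facts:
  assumes "0 \<le> e" "0 \<le> f"
  shows "(top_root e f c - e) * (top_root e f c - f) = e * f * c\<^sup>2"
    and "e \<le> top_root e f c" and "f \<le> top_root e f c"
proof -
  let ?d = "sqrt ((e - f)\<^sup>2 + 4 * e * f * c\<^sup>2)"
  have nn: "0 \<le> (e - f)\<^sup>2 + 4 * e * f * c\<^sup>2" using assms by simp
  then have "?d * ?d = (e - f)\<^sup>2 + 4 * e * f * c\<^sup>2" by simp
  then show "(top_root e f c - e) * (top_root e f c - f) = e * f * c\<^sup>2"
    unfolding top_root_def by (simp add: field_simps power2_eq_square)
  have "\<bar>e - f\<bar> \<le> ?d" using assms by (intro real_le_rsqrt) simp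
  then show "e \<le> top_root e f c" "f \<le> top_root e f c"
    unfolding top_root_def by auto
qed

text \<open>
  The discriminant is \<open>(e + f)\<^sup>2 c\<^sup>2 + (e - f)\<^sup>2 (1 - c\<^sup>2)\<close>, so its square root is at least
  \<open>(e + f) c\<close>. This is the source of the last bound in each chain of the theorem.
\<close>

lemma top_root_ge:
  assumes "0 \<le> e" "0 \<le> f" "0 \<le> c" "c \<le> 1"
  shows "(e + f) * (1 + c) / 2 \<le> top_root e f c"
proof -
  have "c\<^sup>2 \<le> 1" using assms by (simp add: power_le_one)
  then have "0 \<le> (e - f)\<^sup>2 * (1 - c\<^sup>2)" by simp
  then have "((e + f) * c)\<^sup>2 \<le> (e - f)\<^sup>2 + 4 * e * f * c\<^sup>2"
    by (simp add: power2_eq_square algebra_simps)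
  then have "(e + f) * c \<le> sqrt ((e - f)\<^sup>2 + 4 * e * f * c\<^sup>2)" by (rule real_le_rsqrt)
  then show ?thesis unfolding top_root_def by (simp add: algebra_simps)
qed

lemma sum_sqrt_self:
  assumes "prob_vec S p"
  shows "(\<Sum>x\<in>S. sqrt (p x) * sqrt (p x)) = 1"
proof -
  have "(\<Sum>x\<in>S. sqrt (p x) * sqrt (p x)) = sum p S"
    using assms by (intro sum.cong) (auto simp: prob_vec_def)
  then show ?thesis using assms by (simp add: prob_vec_def)
qed

text \<open>
  Taking inner products of the eigenvector equation with \<open>\<surd>p\<close> and \<open>\<surd>q\<close> gives a two by two
  linear system for the inner products \<open>P\<close> and \<open>Q\<close> of these vectors with the eigenvector. Above the
  larger root its determinant is positive, so \<open>P = Q = 0\<close>, and then the eigenvector vanishes.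
\<close>

lemma eigenvalue_le_top_root:
  assumes p: "prob_vec S p" and q: "prob_vec S q" and e: "0 \<le> e" and f: "0 \<le> f"
    and ev: "eigenvector_on S (sqrt_matrix e p f q) \<mu> x"
  shows "\<mu> \<le> top_root e f (\<Sum>x\<in>S. sqrt (p x) * sqrt (q x))" (is "_ \<le> top_root e f ?c")
proof (rule ccontr)
  let ?L = "top_root e f ?c"
  define P where "P = (\<Sum>t\<in>S. sqrt (p t) * x t)"
  define Q where "Q = (\<Sum>t\<in>S. sqrt (q t) * x t)"
  assume "\<not> \<mu> \<le> ?L"
  then have gt: "?L < \<mu>" by simp
  note L = top_root_facts[OF e f, of ?c]
  have eq: "e * P * sqrt (p s) + f * Q * sqrt (q s) = \<mu> * x s" if "s \<in> S" for s
    using ev that unfolding eigenvector_on_def sqrt_matrix_apply P_def Q_def by simp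
  have "\<mu> * P = (\<Sum>s\<in>S. sqrt (p s) * (\<mu> * x s))"
    by (simp add: P_def sum_distrib_left mult_ac)
  also have "\<dots> = (\<Sum>s\<in>S. sqrt (p s) * (e * P * sqrt (p s) + f * Q * sqrt (q s)))"
    using eq by simp
  also have "\<dots> = e * P * (\<Sum>s\<in>S. sqrt (p s) * sqrt (p s)) + f * Q * ?c"
    by (simp only: sum_distrib_left sum.distrib[symmetric]) (simp add: algebra_simps)
  finally have 1: "(\<mu> - e) * P = f * ?c * Q"
    using sum_sqrt_self[OF p] by (simp add: algebra_simps)
  have "\<mu> * Q = (\<Sum>s\<in>S. sqrt (q s) * (\<mu> * x s))"
    by (simp add: Q_def sum_distrib_left mult_ac)
  also have "\<dots> = (\<Sum>s\<in>S. sqrt (q s) * (e * P * sqrt (p s) + f * Q * sqrt (q s)))"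
    using eq by simp
  also have "\<dots> = e * P * ?c + f * Q * (\<Sum>s\<in>S. sqrt (q s) * sqrt (q s))"
    by (simp only: sum_distrib_left sum.distrib[symmetric]) (simp add: algebra_simps)
  finally have 2: "(\<mu> - f) * Q = e * ?c * P"
    using sum_sqrt_self[OF q] by (simp add: algebra_simps)
  have pos: "0 < \<mu> - e" "0 < \<mu> - f" "0 < \<mu>" using L gt e by auto
  have "(?L - e) * (?L - f) < (\<mu> - e) * (\<mu> - f)"
    using L gt pos by (intro mult_strict_mono') auto
  then have ne: "(\<mu> - e) * (\<mu> - f) \<noteq> e * f * ?c\<^sup>2" using L by simp
  have "((\<mu> - e) * (\<mu> - f) - e * f * ?c\<^sup>2) * P = (\<mu> - f) * ((\<mu> - e) * P) - e * f * ?c\<^sup>2 * P"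
    by (simp add: algebra_simps)
  also have "\<dots> = f * ?c * ((\<mu> - f) * Q) - e * f * ?c\<^sup>2 * P"
    unfolding 1 by (simp add: algebra_simps)
  also have "\<dots> = 0"
    unfolding 2 by (simp add: power2_eq_square)
  finally have P0: "P = 0" using ne by simp
  then have Q0: "Q = 0" using 2 pos by simp
  have "\<forall>s\<in>S. x s = 0" using eq pos P0 Q0 by auto
  then show False using ev by (auto simp: eigenvector_on_def)
qed

text \<open>
  The eigenvector is sought as \<open>a \<surd>p + b \<surd>q\<close> with \<open>a, b \<ge> 0\<close>. The equations for \<open>(a, b)\<close> form a
  two by two eigenvalue problem, solved by \<open>a = e c\<close> and \<open>b = L - e\<close> for the larger root \<open>L\<close>
  unless both of these vanish; then \<open>c = 0\<close>, and \<open>\<surd>p\<close> itself is an eigenvector.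
\<close>

lemma top_root_eigenvector:
  assumes p: "prob_vec S p" and q: "prob_vec S q" and e: "0 \<le> e" and f: "0 \<le> f"
    and ef: "0 < e + f" and fin: "finite S"
  shows "\<exists>v. (\<forall>x\<in>S. 0 \<le> v x) \<and> (\<Sum>x\<in>S. v x) = 1 \<and>
    eigenvector_on S (sqrt_matrix e p f q) (top_root e f (\<Sum>x\<in>S. sqrt (p x) * sqrt (q x)))
      (\<lambda>x. sqrt (v x))"
proof -
  define c where "c = (\<Sum>x\<in>S. sqrt (p x) * sqrt (q x))"
  let ?L = "top_root e f c"
  note L = top_root_facts[OF e f, of c]
  have nn: "0 \<le> p x" "0 \<le> q x" if "x \<in> S" for x using p q that by (auto simp: prob_vec_def)
  have c0: "0 \<le> c" unfolding c_def using nn by (intro sum_nonneg) auto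
  obtain a b where ab: "0 \<le> a" "0 \<le> b" "0 < a + b"
    "e * (a + b * c) = ?L * a" "f * (a * c + b) = ?L * b"
  proof (cases "e * c = 0 \<and> ?L = e")
    case True
    then have "0 < e" using L f ef by (cases "e = 0") auto
    then have "c = 0" using True by auto
    then show ?thesis using that[of 1 0] True by auto
  next
    case False
    have "e * (e * c + (?L - e) * c) = ?L * (e * c)" by (simp add: algebra_simps)
    moreover have "f * (e * c * c + (?L - e)) = ?L * (?L - e)"
      using L(1) by (simp add: power2_eq_square algebra_simps)
    moreover have "0 \<le> e * c" using e c0 by simp
    moreover have "0 < e * c + (?L - e)" using False L(2) \<open>0 \<le> e * c\<close> by linarith
    ultimately show ?thesis using that[of "e * c" "?L - e"] L(2) by simp
  qed
  define y where "y x = a * sqrt (p x) + b * sqrt (q x)" for x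
  have y0: "0 \<le> y x" if "x \<in> S" for x using nn[OF that] ab by (simp add: y_def)
  have py: "(\<Sum>t\<in>S. sqrt (p t) * y t) = a + b * c"
  proof -
    have "(\<Sum>t\<in>S. sqrt (p t) * y t) = a * (\<Sum>s\<in>S. sqrt (p s) * sqrt (p s)) + b * c"
      unfolding c_def y_def
      by (simp only: sum_distrib_left sum.distrib[symmetric]) (simp add: algebra_simps)
    then show ?thesis using sum_sqrt_self[OF p] by simp
  qed
  have qy: "(\<Sum>t\<in>S. sqrt (q t) * y t) = a * c + b"
  proof -
    have "(\<Sum>t\<in>S. sqrt (q t) * y t) = a * c + b * (\<Sum>s\<in>S. sqrt (q s) * sqrt (q s))"
      unfolding c_def y_def
      by (simp only: sum_distrib_left sum.distrib[symmetric]) (simp add: algebra_simps)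
    then show ?thesis using sum_sqrt_self[OF q] by simp
  qed
  define N where "N = (\<Sum>t\<in>S. (y t)\<^sup>2)"
  have "N = a * (\<Sum>t\<in>S. sqrt (p t) * y t) + b * (\<Sum>t\<in>S. sqrt (q t) * y t)"
    unfolding N_def sum_distrib_left sum.distrib[symmetric]
    by (intro sum.cong) (auto simp: y_def power2_eq_square algebra_simps)
  also have "\<dots> = a * a + b * b + 2 * (a * b * c)" unfolding py qy by (simp add: algebra_simps)
  also have "\<dots> > 0"
  proof -
    have "0 < a * a + b * b" using ab by (cases "a = 0") (auto simp: add_pos_nonneg)
    then show ?thesis using ab c0 by (simp add: add_pos_nonneg)
  qed
  finally have N0: "0 < N" .
  let ?v = "\<lambda>x. (y x)\<^sup>2 / N"
  have sq: "sqrt (?v x) = y x / sqrt N" if "x \<in> S" for x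
    using y0[OF that] by (simp add: real_sqrt_divide)
  have "eigenvector_on S (sqrt_matrix e p f q) ?L (\<lambda>x. sqrt (?v x))"
    unfolding eigenvector_on_def
  proof (intro conjI ballI)
    show "\<exists>s\<in>S. sqrt (?v s) \<noteq> 0"
    proof (rule ccontr)
      assume "\<not> ?thesis"
      then have "\<forall>s\<in>S. y s = 0" using sq N0 by simp
      then have "N = 0" unfolding N_def by (intro sum.neutral) simp
      then show False using N0 by simp
    qed
    fix s assume s: "s \<in> S"
    have "(\<Sum>t\<in>S. sqrt_matrix e p f q s t * sqrt (?v t)) =
        (\<Sum>t\<in>S. sqrt_matrix e p f q s t * (y t / sqrt N))" using sq by simp
    also have "\<dots> = (\<Sum>t\<in>S. sqrt_matrix e p f q s t * y t) / sqrt N"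
      by (simp add: sum_divide_distrib)
    also have "\<dots> = (?L * a * sqrt (p s) + ?L * b * sqrt (q s)) / sqrt N"
      unfolding sqrt_matrix_apply py qy ab(4,5) ..
    also have "\<dots> = ?L * sqrt (?v s)" unfolding sq[OF s] by (simp add: y_def algebra_simps)
    finally show "(\<Sum>t\<in>S. sqrt_matrix e p f q s t * sqrt (?v t)) = ?L * sqrt (?v s)" .
  qed
  moreover have "(\<Sum>x\<in>S. ?v x) = 1"
    using N0 by (simp add: N_def flip: sum_divide_distrib)
  moreover have "\<forall>x\<in>S. 0 \<le> ?v x" using N0 by simp
  ultimately show ?thesis unfolding c_def[symmetric] by (intro exI[of _ ?v] conjI)
qed

lemma lambda_max_sqrt_matrix:
  assumes "prob_vec S p" "prob_vec S q" "0 \<le> e" "0 \<le> f" "0 < e + f" "finite S"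
  shows "lambda_max S (sqrt_matrix e p f q) = top_root e f (\<Sum>x\<in>S. sqrt (p x) * sqrt (q x))"
  unfolding lambda_max_def
proof (rule Greatest_equality)
  show "\<exists>x. eigenvector_on S (sqrt_matrix e p f q)
      (top_root e f (\<Sum>x\<in>S. sqrt (p x) * sqrt (q x))) x"
    using top_root_eigenvector[OF assms] by blast
qed (use eigenvalue_le_top_root assms in blast)

lemma principal_eigenvector_exists:
  assumes "prob_vec S p" "prob_vec S q" "0 \<le> e" "0 \<le> f" "0 < e + f" "finite S"
  shows "\<exists>v. (\<forall>x\<in>S. 0 \<le> v x) \<and> principal_eigenvector S (sqrt_matrix e p f q) (\<lambda>x. sqrt (v x))"
proof -
  obtain v where v: "\<forall>x\<in>S. 0 \<le> v x" "(\<Sum>x\<in>S. v x) = 1"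
    "eigenvector_on S (sqrt_matrix e p f q) (lambda_max S (sqrt_matrix e p f q)) (\<lambda>x. sqrt (v x))"
    using top_root_eigenvector[OF assms] lambda_max_sqrt_matrix[OF assms] by auto
  then have "(\<Sum>x\<in>S. (sqrt (v x))\<^sup>2) = 1" by simp
  then show ?thesis using v unfolding principal_eigenvector_def by auto
qed

text \<open>
  The largest eigenvalue is the value of the quadratic form at the unit vector \<open>\<surd>v\<close>, and each of
  its two rank-one parts contributes the square of an inner product, that is, a fidelity.
\<close>

lemma principal_eigenvector_fidelity:
  assumes v: "\<forall>x\<in>S. 0 \<le> v x"
    and pe: "principal_eigenvector S (sqrt_matrix e p f q) (\<lambda>x. sqrt (v x))"
  shows "prob_vec S v"
    and "lambda_max S (sqrt_matrix e p f q) = e * fidelity S v p + f * fidelity S v q"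
proof -
  have "(\<Sum>x\<in>S. (sqrt (v x))\<^sup>2) = sum v S" using v by (intro sum.cong) auto
  then have one: "sum v S = 1" using pe by (simp add: principal_eigenvector_def)
  then show "prob_vec S v" using v by (simp add: prob_vec_def)
  let ?L = "lambda_max S (sqrt_matrix e p f q)"
  define P where "P = (\<Sum>t\<in>S. sqrt (p t) * sqrt (v t))"
  define Q where "Q = (\<Sum>t\<in>S. sqrt (q t) * sqrt (v t))"
  have eq: "e * P * sqrt (p s) + f * Q * sqrt (q s) = ?L * sqrt (v s)" if "s \<in> S" for s
    using pe that
    unfolding principal_eigenvector_def eigenvector_on_def sqrt_matrix_apply P_def Q_def by simp
  have "?L = ?L * sum v S" using one by simp
  also have "\<dots> = (\<Sum>s\<in>S. (?L * sqrt (v s)) * sqrt (v s))"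
    unfolding sum_distrib_left using v by (intro sum.cong) auto
  also have "\<dots> = (\<Sum>s\<in>S. (e * P * sqrt (p s) + f * Q * sqrt (q s)) * sqrt (v s))"
    using eq by simp
  also have "\<dots> = e * P * P + f * Q * Q"
    by (simp only: P_def Q_def sum_distrib_left sum.distrib[symmetric]) (simp add: algebra_simps P_def Q_def)
  finally show "?L = e * fidelity S v p + f * fidelity S v q"
    by (simp add: fidelity_def P_def Q_def power2_eq_square mult.commute)
qed

text \<open>
  Both sides are the sum of the pointwise maxima of \<open>p\<close> and \<open>q\<close>.
\<close>

lemma eta_plus_tau:
  assumes "finite S" "prob_vec S p" "prob_vec S q"
  shows "eta S p q + tau S p q = 1 + trace_dist S p q"
proof -
  have "eta S p q + tau S p q = (\<Sum>y\<in>S. max (p y) (q y))"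
  proof -
    have "(\<Sum>y\<in>S. max (p y) (q y)) =
        (\<Sum>y\<in>{y\<in>S. p y \<ge> q y}. max (p y) (q y)) + (\<Sum>y\<in>{y\<in>S. p y < q y}. max (p y) (q y))"
      using assms(1) by (subst sum.union_disjoint[symmetric]) (auto intro!: sum.cong)
    then show ?thesis unfolding eta_def tau_def by simp
  qed
  also have "\<dots> = (\<Sum>y\<in>S. (p y + q y + \<bar>p y - q y\<bar>) / 2)"
    by (intro sum.cong) (auto simp: max_def)
  also have "\<dots> = 1 + trace_dist S p q"
    using assms by (simp add: prob_vec_def trace_dist_def sum.distrib flip: sum_divide_distrib)
  finally show ?thesis .
qed

lemma eta_tau_nonneg:
  assumes "prob_vec S p" "prob_vec S q"
  shows "0 \<le> eta S p q" "0 \<le> tau S p q"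
  using assms by (auto simp: eta_def tau_def prob_vec_def intro!: sum_nonneg)

lemma eta_tau_pos:
  assumes "finite S" "prob_vec S p" "prob_vec S q"
  shows "0 < eta S p q + tau S p q"
  using eta_plus_tau[OF assms] by (simp add: trace_dist_def sum_nonneg add_pos_nonneg)

lemma trace_dist_commute: "trace_dist S p q = trace_dist S q p"
  by (simp add: trace_dist_def abs_minus_commute)

lemma half_lambda_max_ge:
  assumes "finite S" "prob_vec S p" "prob_vec S q" "finite T" "prob_vec T b0" "prob_vec T b1"
  shows "(1 / 2 + 1 / 2 * sqrt (fidelity S p q)) * (1 / 2 + 1 / 2 * trace_dist T b0 b1)
    \<le> 1 / 2 * lambda_max S (sqrt_matrix (eta T b0 b1) p (tau T b0 b1) q)"
proof -
  let ?c = "\<Sum>x\<in>S. sqrt (p x) * sqrt (q x)"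
  have c: "0 \<le> ?c" "?c \<le> 1"
    using assms affinity_le_one[of S p q] by (auto simp: prob_vec_def intro!: sum_nonneg)
  have "(eta T b0 b1 + tau T b0 b1) * (1 + ?c) / 2
      \<le> top_root (eta T b0 b1) (tau T b0 b1) ?c"
    using c eta_tau_nonneg assms by (intro top_root_ge) auto
  also have "\<dots> = lambda_max S (sqrt_matrix (eta T b0 b1) p (tau T b0 b1) q)"
    using assms eta_tau_nonneg eta_tau_pos by (intro lambda_max_sqrt_matrix[symmetric]) auto
  finally show ?thesis
    using c unfolding eta_plus_tau[OF assms(4-6)]
    by (simp add: fidelity_def field_simps)
qed

section \<open>Concavity of the fidelity and the concave hull\<close>

lemma fidelity_scale:
  assumes "0 \<le> t"
  shows "fidelity S (\<lambda>x. t * p x) q = t * fidelity S p q"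
proof -
  have "(\<Sum>x\<in>S. sqrt (t * p x) * sqrt (q x)) = sqrt t * (\<Sum>x\<in>S. sqrt (p x) * sqrt (q x))"
    by (simp add: sum_distrib_left real_sqrt_mult mult.assoc)
  then show ?thesis using assms by (simp add: fidelity_def power_mult_distrib)
qed

text \<open>
  Expanding the square, this holds term by term: it is the Cauchy-Schwarz inequality in the
  plane. Together with homogeneity it makes the
  fidelity concave in its first argument.
\<close>

lemma fidelity_superadditive:
  assumes "\<forall>x\<in>S. 0 \<le> p x" "\<forall>x\<in>S. 0 \<le> p' x" "\<forall>x\<in>S. 0 \<le> q x"
  shows "fidelity S p q + fidelity S p' q \<le> fidelity S (\<lambda>x. p x + p' x) q"
proof -
  have cauchy: "sqrt a * sqrt b + sqrt a' * sqrt b' \<le> sqrt (a + a') * sqrt (b + b')"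
    if "0 \<le> a" "0 \<le> a'" "0 \<le> b" "0 \<le> b'" for a a' b b' :: real
  proof -
    have "2 * (sqrt (a * b') * sqrt (a' * b)) \<le> a * b' + a' * b"
      using arith_geo_mean_sqrt[of "a * b'" "a' * b"] that by (simp add: real_sqrt_mult)
    moreover have "(sqrt a * sqrt b + sqrt a' * sqrt b')\<^sup>2
        = a * b + a' * b' + 2 * (sqrt (a * b') * sqrt (a' * b))"
      using that by (simp add: power2_sum power_mult_distrib real_sqrt_mult mult_ac)
    ultimately have "(sqrt a * sqrt b + sqrt a' * sqrt b')\<^sup>2 \<le> (a + a') * (b + b')"
      by (simp add: algebra_simps)
    then show ?thesis by (metis real_le_rsqrt real_sqrt_mult)
  qed
  have expand: "fidelity S r q = (\<Sum>x\<in>S. \<Sum>z\<in>S. sqrt (q x) * sqrt (q z) * (sqrt (r x) * sqrt (r z)))"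
    for r by (simp add: fidelity_def power2_eq_square sum_product mult_ac)
  have "(\<Sum>x\<in>S. \<Sum>z\<in>S. sqrt (q x) * sqrt (q z) *
            (sqrt (p x) * sqrt (p z) + sqrt (p' x) * sqrt (p' z)))
      \<le> (\<Sum>x\<in>S. \<Sum>z\<in>S. sqrt (q x) * sqrt (q z) * (sqrt (p x + p' x) * sqrt (p z + p' z)))"
    using assms by (intro sum_mono mult_left_mono cauchy) auto
  then show ?thesis unfolding expand by (simp add: sum.distrib distrib_left)
qed

lemma fidelity_concave:
  assumes "\<forall>x\<in>S. 0 \<le> p x" "\<forall>x\<in>S. 0 \<le> p' x" "\<forall>x\<in>S. 0 \<le> q x" "0 \<le> t" "t \<le> 1"
  shows "(1 - t) * fidelity S p q + t * fidelity S p' q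
    \<le> fidelity S (\<lambda>x. (1 - t) * p x + t * p' x) q"
  using fidelity_superadditive[of S "\<lambda>x. (1 - t) * p x" "\<lambda>x. t * p' x" q] assms
    fidelity_scale[of "1 - t" S p q] fidelity_scale[of t S p' q] by simp

lemma fidelity_mono:
  assumes "\<forall>x\<in>S. 0 \<le> p x \<and> p x \<le> p' x" "\<forall>x\<in>S. 0 \<le> q x"
  shows "fidelity S p q \<le> fidelity S p' q"
  unfolding fidelity_def using assms
  by (intro power_mono sum_mono mult_right_mono sum_nonneg) auto

lemma fidelity_cong:
  "(\<And>x. x \<in> S \<Longrightarrow> p x = p' x) \<Longrightarrow> fidelity S p q = fidelity S p' q"
  by (simp add: fidelity_def cong: sum.cong)

lemma concave_ext_Inf:
  assumes "\<And>f. f \<in> X \<Longrightarrow> concave_ext f"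
  shows "concave_ext (Inf X)"
  unfolding concave_ext_def
proof (intro allI impI)
  fix u w :: "'a \<Rightarrow> real" and r q t :: real
  assume *: "0 \<le> t \<and> t \<le> 1 \<and> ereal r \<le> Inf X u \<and> ereal q \<le> Inf X w"
  have "ereal ((1 - t) * r + t * q) \<le> f (\<lambda>s. (1 - t) * u s + t * w s)" if "f \<in> X" for f
  proof -
    have "ereal r \<le> f u" "ereal q \<le> f w" using * that by (auto simp: le_INF_iff)
    then show ?thesis using assms[OF that] * unfolding concave_ext_def by blast
  qed
  then show "ereal ((1 - t) * r + t * q) \<le> Inf X (\<lambda>s. (1 - t) * u s + t * w s)"
    by (simp add: le_INF_iff)
qed

text \<open>
  A least concave majorant exists because a pointwise infimum of concave functions is concave; so
  the concave hull lies below every concave majorant and above the given functions.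
\<close>

lemma conc_eq_Inf: "conc G = Inf {f. concave_ext f \<and> (\<forall>g\<in>G. g \<le> f)}"
  unfolding conc_def by (rule Least_equality) (auto intro!: concave_ext_Inf Inf_lower Inf_greatest)

lemma conc_upper: "concave_ext f \<Longrightarrow> (\<And>g. g \<in> G \<Longrightarrow> g \<le> f) \<Longrightarrow> conc G \<le> f"
  unfolding conc_eq_Inf by (rule Inf_lower) simp

lemma conc_ge: "g \<in> G \<Longrightarrow> g \<le> conc G"
  unfolding conc_eq_Inf by (rule Inf_greatest) auto

text \<open>
  The functions \<open>c\<^sub>0 F(\<cdot>, q\<^sub>0)\<close> and \<open>c\<^sub>1 F(\<cdot>, q\<^sub>1)\<close> are homogeneous of degree one, so a convex
  combination of their values at points averaging to \<open>u\<close> is a sum of their values at a splitting of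
  \<open>u\<close> into two nonnegative parts, here \<open>s\<close> and \<open>u - s\<close>.
\<close>

definition split_value ::
    "'s set \<Rightarrow> real \<Rightarrow> ('s \<Rightarrow> real) \<Rightarrow> real \<Rightarrow> ('s \<Rightarrow> real) \<Rightarrow> ('s \<Rightarrow> real) \<Rightarrow> ('s \<Rightarrow> real) \<Rightarrow> real" where
  "split_value S c0 q0 c1 q1 u s =
     c0 * fidelity S s q0 + c1 * fidelity S (\<lambda>x. u x - s x) q1"

definition splits :: "'s set \<Rightarrow> ('s \<Rightarrow> real) \<Rightarrow> ('s \<Rightarrow> real) set" where
  "splits S u = {s. \<forall>x\<in>S. 0 \<le> s x \<and> s x \<le> u x}"

definition best_split ::
    "'s set \<Rightarrow> real \<Rightarrow> ('s \<Rightarrow> real) \<Rightarrow> real \<Rightarrow> ('s \<Rightarrow> real) \<Rightarrow> ('s \<Rightarrow> real) \<Rightarrow> real" where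
  "best_split S c0 q0 c1 q1 u = Sup (split_value S c0 q0 c1 q1 u ` splits S u)"

context
  fixes S :: "'s set" and c0 c1 :: real and q0 q1 :: "'s \<Rightarrow> real"
  assumes c: "0 \<le> c0" "0 \<le> c1" and q: "\<forall>x\<in>S. 0 \<le> q0 x" "\<forall>x\<in>S. 0 \<le> q1 x"
begin

lemma split_value_bdd: "bdd_above (split_value S c0 q0 c1 q1 u ` splits S u)"
proof (rule bdd_aboveI)
  fix r assume "r \<in> split_value S c0 q0 c1 q1 u ` splits S u"
  then obtain s where s: "s \<in> splits S u" "r = split_value S c0 q0 c1 q1 u s" by auto
  show "r \<le> c0 * fidelity S u q0 + c1 * fidelity S u q1"
    unfolding s split_value_def using s(1) c q
    by (intro add_mono mult_left_mono fidelity_mono) (auto simp: splits_def)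
qed

lemma split_value_le_best: "s \<in> splits S u \<Longrightarrow> split_value S c0 q0 c1 q1 u s \<le> best_split S c0 q0 c1 q1 u"
  unfolding best_split_def by (intro cSup_upper split_value_bdd) auto

lemma near_best_split:
  assumes "\<forall>x\<in>S. 0 \<le> u x" "0 < \<epsilon>"
  obtains s where "s \<in> splits S u" "best_split S c0 q0 c1 q1 u - \<epsilon> < split_value S c0 q0 c1 q1 u s"
proof -
  have "u \<in> splits S u" using assms by (auto simp: splits_def)
  then have ne: "split_value S c0 q0 c1 q1 u ` splits S u \<noteq> {}" by auto
  have "best_split S c0 q0 c1 q1 u - \<epsilon> < Sup (split_value S c0 q0 c1 q1 u ` splits S u)"
    using assms(2) by (simp add: best_split_def)
  then obtain r where "r \<in> split_value S c0 q0 c1 q1 u ` splits S u"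
    "best_split S c0 q0 c1 q1 u - \<epsilon> < r" using ne by (rule less_cSupE)
  then show thesis using that by auto
qed

text \<open>
  The supremum over all splittings is itself a concave majorant: splittings of \<open>u\<close> and \<open>w\<close> combine
  to a splitting of \<open>(1 - t) u + t w\<close>, whose value is no smaller because the fidelity is concave.
\<close>

lemma conc_le_best_split:
  assumes u: "\<forall>x\<in>S. 0 \<le> u x"
  shows "conc {scaled_fid S c0 q0, scaled_fid S c1 q1} u \<le> ereal (best_split S c0 q0 c1 q1 u)"
proof -
  let ?b = "best_split S c0 q0 c1 q1"
  let ?h = "\<lambda>u. if \<forall>x\<in>S. 0 \<le> u x then ereal (?b u) else - \<infinity>"
  have "concave_ext ?h"
    unfolding concave_ext_def
  proof (intro allI impI)
    fix u w :: "'s \<Rightarrow> real" and r k t :: real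
    assume *: "0 \<le> t \<and> t \<le> 1 \<and> ereal r \<le> ?h u \<and> ereal k \<le> ?h w"
    then have t: "0 \<le> t" "t \<le> 1" and u: "\<forall>x\<in>S. 0 \<le> u x" "r \<le> ?b u"
      and w: "\<forall>x\<in>S. 0 \<le> w x" "k \<le> ?b w" by (auto split: if_splits)
    let ?m = "\<lambda>s. (1 - t) * u s + t * w s"
    have m: "\<forall>x\<in>S. 0 \<le> ?m x" using t u w by auto
    have "(1 - t) * r + t * k \<le> ?b ?m"
    proof (rule field_le_epsilon)
      fix \<epsilon> :: real assume e: "0 < \<epsilon>"
      obtain s where s: "s \<in> splits S u" "?b u - \<epsilon> < split_value S c0 q0 c1 q1 u s"
        using near_best_split[OF u(1) e] .
      obtain s' where s': "s' \<in> splits S w" "?b w - \<epsilon> < split_value S c0 q0 c1 q1 w s'"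
        using near_best_split[OF w(1) e] .
      let ?s = "\<lambda>x. (1 - t) * s x + t * s' x"
      have in_s: "?s \<in> splits S ?m"
        using s(1) s'(1) t by (auto simp: splits_def intro!: add_mono mult_left_mono)
      have F0: "(1 - t) * fidelity S s q0 + t * fidelity S s' q0 \<le> fidelity S ?s q0"
        using s(1) s'(1) q t by (intro fidelity_concave) (auto simp: splits_def)
      have "(1 - t) * fidelity S (\<lambda>x. u x - s x) q1 + t * fidelity S (\<lambda>x. w x - s' x) q1
          \<le> fidelity S (\<lambda>x. (1 - t) * (u x - s x) + t * (w x - s' x)) q1"
        using s(1) s'(1) q t by (intro fidelity_concave) (auto simp: splits_def)
      also have "\<dots> = fidelity S (\<lambda>x. ?m x - ?s x) q1"
        by (intro fidelity_cong) (simp add: algebra_simps)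
      finally have F1: "(1 - t) * fidelity S (\<lambda>x. u x - s x) q1 + t * fidelity S (\<lambda>x. w x - s' x) q1
          \<le> fidelity S (\<lambda>x. ?m x - ?s x) q1" .
      have "(1 - t) * r + t * k \<le> (1 - t) * (split_value S c0 q0 c1 q1 u s + \<epsilon>)
          + t * (split_value S c0 q0 c1 q1 w s' + \<epsilon>)"
        using t s s' u w by (intro add_mono mult_left_mono) auto
      also have "\<dots> = c0 * ((1 - t) * fidelity S s q0 + t * fidelity S s' q0)
          + c1 * ((1 - t) * fidelity S (\<lambda>x. u x - s x) q1 + t * fidelity S (\<lambda>x. w x - s' x) q1) + \<epsilon>"
        by (simp add: split_value_def algebra_simps)
      also have "\<dots> \<le> split_value S c0 q0 c1 q1 ?m ?s + \<epsilon>"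
        unfolding split_value_def using F0 F1 c by (intro add_mono mult_left_mono) auto
      also have "\<dots> \<le> ?b ?m + \<epsilon>"
        using split_value_le_best[OF in_s] by simp
      finally show "(1 - t) * r + t * k \<le> ?b ?m + \<epsilon>" .
    qed
    then show "ereal ((1 - t) * r + t * k) \<le> ?h ?m" using m by simp
  qed
  moreover have "scaled_fid S c0 q0 p \<le> ?h p" for p
  proof (cases "\<forall>x\<in>S. 0 \<le> p x")
    case True
    then have "p \<in> splits S p" by (auto simp: splits_def)
    from split_value_le_best[OF this] show ?thesis
      using True by (simp add: scaled_fid_def split_value_def fidelity_def)
  qed (auto simp: scaled_fid_def)
  moreover have "scaled_fid S c1 q1 p \<le> ?h p" for p
  proof (cases "\<forall>x\<in>S. 0 \<le> p x")
    case True
    then have "(\<lambda>x. 0) \<in> splits S p" by (auto simp: splits_def)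
    from split_value_le_best[OF this] show ?thesis
      using True by (simp add: scaled_fid_def split_value_def fidelity_def)
  qed (auto simp: scaled_fid_def)
  ultimately have "conc {scaled_fid S c0 q0, scaled_fid S c1 q1} \<le> ?h"
    by (intro conc_upper le_funI) (assumption | elim insertE emptyE | simp only:)+
  then have "conc {scaled_fid S c0 q0, scaled_fid S c1 q1} u \<le> ?h u" by (rule le_funD)
  then show ?thesis using u by simp
qed

end

text \<open>
  What turns a bound for strategies, each of which realizes one splitting for every \<open>y\<close>, into
  a bound for the sum of concave hulls: near-optimal splittings are chosen separately for each \<open>y\<close>, with an
  arbitrarily small total error.
\<close>

lemma sum_conc_le:
  assumes fin: "finite Y"
    and c: "\<And>y. y \<in> Y \<Longrightarrow> 0 \<le> c0 y \<and> 0 \<le> c1 y"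
    and q: "\<forall>x\<in>S. 0 \<le> q0 x" "\<forall>x\<in>S. 0 \<le> q1 x" and u: "\<forall>x\<in>S. 0 \<le> u x"
    and bound: "\<And>s. (\<And>y. y \<in> Y \<Longrightarrow> s y \<in> splits S u) \<Longrightarrow>
      (\<Sum>y\<in>Y. split_value S (c0 y) q0 (c1 y) q1 u (s y)) \<le> K"
  shows "(\<Sum>y\<in>Y. conc {scaled_fid S (c0 y) q0, scaled_fid S (c1 y) q1} u) \<le> ereal K"
proof -
  let ?b = "\<lambda>y. best_split S (c0 y) q0 (c1 y) q1 u"
  have "(\<Sum>y\<in>Y. ?b y) \<le> K"
  proof (rule field_le_epsilon)
    fix \<epsilon> :: real assume e: "0 < \<epsilon>"
    \<comment> \<open>The summand \<open>1\<close> covers the case of an empty \<open>Y\<close>.\<close>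
    define \<delta> where "\<delta> = \<epsilon> / (card Y + 1)"
    have d: "0 < \<delta>" "card Y * \<delta> \<le> \<epsilon>" using e by (auto simp: \<delta>_def field_simps)
    have "\<forall>y. \<exists>s. y \<in> Y \<longrightarrow> s \<in> splits S u \<and> ?b y - \<delta> < split_value S (c0 y) q0 (c1 y) q1 u s"
      using near_best_split[OF _ _ q u d(1)] c by metis
    then obtain s where s: "\<And>y. y \<in> Y \<Longrightarrow> s y \<in> splits S u"
      "\<And>y. y \<in> Y \<Longrightarrow> ?b y - \<delta> < split_value S (c0 y) q0 (c1 y) q1 u (s y)" by metis
    have "(\<Sum>y\<in>Y. ?b y) \<le> (\<Sum>y\<in>Y. split_value S (c0 y) q0 (c1 y) q1 u (s y) + \<delta>)"
      using s(2) by (intro sum_mono) (simp add: less_imp_le algebra_simps)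
    also have "\<dots> \<le> K + \<epsilon>" using bound[of s] s(1) d(2) by (simp add: sum.distrib)
    finally show "(\<Sum>y\<in>Y. ?b y) \<le> K + \<epsilon>" .
  qed
  moreover have "(\<Sum>y\<in>Y. conc {scaled_fid S (c0 y) q0, scaled_fid S (c1 y) q1} u) \<le> (\<Sum>y\<in>Y. ereal (?b y))"
    using c conc_le_best_split[OF _ _ q u] by (intro sum_mono) auto
  ultimately show ?thesis by (simp add: order_trans)
qed

text \<open>
  At each \<open>y\<close> the hull is bounded below by the function with the larger of the two coefficients;
  the sets of \<open>y\<close> where this is the first or the second one are those defining \<open>eta\<close> and \<open>tau\<close>.
\<close>

lemma sum_conc_ge:
  assumes "finite Y" "\<forall>x\<in>S. 0 \<le> u x"
  shows "ereal (eta Y c0 c1 * fidelity S u q0 + tau Y c0 c1 * fidelity S u q1)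
    \<le> (\<Sum>y\<in>Y. conc {scaled_fid S (c0 y) q0, scaled_fid S (c1 y) q1} u)"
proof -
  let ?f = "\<lambda>y. if c0 y \<ge> c1 y then c0 y * fidelity S u q0 else c1 y * fidelity S u q1"
  have "eta Y c0 c1 * fidelity S u q0 + tau Y c0 c1 * fidelity S u q1 = (\<Sum>y\<in>Y. ?f y)"
    using assms(1) unfolding eta_def tau_def
    by (simp add: sum.If_cases sum_distrib_right Int_def not_le)
  also have "ereal \<dots> = (\<Sum>y\<in>Y. ereal (?f y))" by simp
  also have "\<dots> \<le> (\<Sum>y\<in>Y. conc {scaled_fid S (c0 y) q0, scaled_fid S (c1 y) q1} u)"
  proof (rule sum_mono)
    fix y
    have "scaled_fid S (c0 y) q0 u \<le> conc {scaled_fid S (c0 y) q0, scaled_fid S (c1 y) q1} u"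
      "scaled_fid S (c1 y) q1 u \<le> conc {scaled_fid S (c0 y) q0, scaled_fid S (c1 y) q1} u"
      by (intro le_funD[OF conc_ge], simp)+
    then show "ereal (?f y) \<le> conc {scaled_fid S (c0 y) q0, scaled_fid S (c1 y) q1} u"
      using assms(2) by (simp add: scaled_fid_def)
  qed
  finally show ?thesis .
qed

section \<open>Positive semidefinite matrices and local operations\<close>

text \<open>
  Up to the diagonal factor \<open>a\<close>, the quadratic form of the new matrix at \<open>f\<close> is that of \<open>N\<close> at the
  vector obtained by summing \<open>f\<close> over the fibres of \<open>\<kappa>\<close>. With an injective or surjective \<open>\<kappa>\<close> this
  covers relabelling the basis, compression, and tensoring with a rank-one matrix.
\<close>

lemma psd_on_pullback:
  assumes "finite G" "finite H" "\<kappa> ` G \<subseteq> H" "psd_on H N"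
  shows "psd_on G (\<lambda>g h. a g * cnj (a h) * N (\<kappa> g) (\<kappa> h))"
  unfolding psd_on_def
proof
  fix f :: "'a \<Rightarrow> complex"
  define F where "F c = (\<Sum>g\<in>{g \<in> G. \<kappa> g = c}. cnj (a g) * f g)" for c
  have "(\<Sum>g\<in>G. \<Sum>h\<in>G. cnj (f g) * (a g * cnj (a h) * N (\<kappa> g) (\<kappa> h)) * f h)
      = (\<Sum>c\<in>H. \<Sum>g\<in>{g \<in> G. \<kappa> g = c}. \<Sum>d\<in>H. \<Sum>h\<in>{h \<in> G. \<kappa> h = d}.
          cnj (f g) * (a g * cnj (a h) * N (\<kappa> g) (\<kappa> h)) * f h)"
    using assms(1-3) by (simp only: sum.group)
  also have "\<dots> = (\<Sum>c\<in>H. \<Sum>d\<in>H. \<Sum>g\<in>{g \<in> G. \<kappa> g = c}. \<Sum>h\<in>{h \<in> G. \<kappa> h = d}.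
          cnj (f g) * (a g * cnj (a h) * N (\<kappa> g) (\<kappa> h)) * f h)"
    by (intro sum.cong refl sum.swap)
  also have "\<dots> = (\<Sum>c\<in>H. \<Sum>d\<in>H. cnj (F c) * N c d * F d)"
  proof (intro sum.cong refl)
    fix c d
    have "(\<Sum>g\<in>{g \<in> G. \<kappa> g = c}. \<Sum>h\<in>{h \<in> G. \<kappa> h = d}.
          cnj (f g) * (a g * cnj (a h) * N (\<kappa> g) (\<kappa> h)) * f h)
        = (\<Sum>g\<in>{g \<in> G. \<kappa> g = c}. \<Sum>h\<in>{h \<in> G. \<kappa> h = d}.
          cnj (cnj (a g) * f g) * N c d * (cnj (a h) * f h))"
      by (intro sum.cong refl) (auto simp: mult_ac)
    also have "\<dots> = cnj (F c) * N c d * F d"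
      by (simp only: F_def cnj_sum sum_distrib_left sum_distrib_right) (rule sum.swap)
    finally show "(\<Sum>g\<in>{g \<in> G. \<kappa> g = c}. \<Sum>h\<in>{h \<in> G. \<kappa> h = d}.
          cnj (f g) * (a g * cnj (a h) * N (\<kappa> g) (\<kappa> h)) * f h) = cnj (F c) * N c d * F d" .
  qed
  finally show "(\<Sum>g\<in>G. \<Sum>h\<in>G. cnj (f g) * (a g * cnj (a h) * N (\<kappa> g) (\<kappa> h)) * f h) \<in> \<real>\<^sub>\<ge>\<^sub>0"
    using assms(4)[unfolded psd_on_def, rule_format, of F] by simp
qed

lemma psd_on_sum:
  assumes "\<And>r. r \<in> R \<Longrightarrow> psd_on S (M r)"
  shows "psd_on S (\<lambda>s t. \<Sum>r\<in>R. M r s t)"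
  unfolding psd_on_def
proof
  fix f
  have "(\<Sum>s\<in>S. \<Sum>t\<in>S. cnj (f s) * (\<Sum>r\<in>R. M r s t) * f t)
      = (\<Sum>s\<in>S. \<Sum>r\<in>R. \<Sum>t\<in>S. cnj (f s) * M r s t * f t)"
    unfolding sum_distrib_left sum_distrib_right by (intro sum.cong refl sum.swap)
  also have "\<dots> = (\<Sum>r\<in>R. \<Sum>s\<in>S. \<Sum>t\<in>S. cnj (f s) * M r s t * f t)"
    by (rule sum.swap)
  also have "\<dots> \<in> \<real>\<^sub>\<ge>\<^sub>0"
    using assms by (induction R rule: infinite_finite_induct) (auto simp: psd_on_def)
  finally show "(\<Sum>s\<in>S. \<Sum>t\<in>S. cnj (f s) * (\<Sum>r\<in>R. M r s t) * f t) \<in> \<real>\<^sub>\<ge>\<^sub>0" .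
qed

lemma psd_on_cong:
  assumes "\<And>s t. s \<in> S \<Longrightarrow> t \<in> S \<Longrightarrow> M s t = N s t"
  shows "psd_on S M \<longleftrightarrow> psd_on S N"
  using assms unfolding psd_on_def by (simp cong: sum.cong)

lemma psd_on_rank_one: "psd_on S (\<lambda>s t. \<xi> s * cnj (\<xi> t))"
  unfolding psd_on_def
proof
  fix f
  have "(\<Sum>s\<in>S. \<Sum>t\<in>S. cnj (f s) * (\<xi> s * cnj (\<xi> t)) * f t)
      = (\<Sum>s\<in>S. cnj (f s) * \<xi> s) * cnj (\<Sum>s\<in>S. cnj (f s) * \<xi> s)"
    by (simp add: sum_product mult_ac)
  also have "\<dots> \<in> \<real>\<^sub>\<ge>\<^sub>0"
    unfolding complex_mult_cnj nonneg_Reals_of_real_iff by simp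
  finally show "(\<Sum>s\<in>S. \<Sum>t\<in>S. cnj (f s) * (\<xi> s * cnj (\<xi> t)) * f t) \<in> \<real>\<^sub>\<ge>\<^sub>0" .
qed

text \<open>
  The quadratic form evaluated at the difference of two basis vectors.
\<close>

lemma psd_off_diagonal:
  assumes "psd_on S M" "finite S" "g \<in> S" "h \<in> S"
  shows "Re (M g h) + Re (M h g) \<le> Re (M g g) + Re (M h h)"
proof -
  define f :: "'a \<Rightarrow> complex" where "f s = of_bool (s = g) - of_bool (s = h)" for s
  have row: "(\<Sum>t\<in>S. k t * f t) = k g - k h" for k
    using assms(2-4) by (simp add: f_def right_diff_distrib sum_subtractf)
  have "(\<Sum>s\<in>S. \<Sum>t\<in>S. cnj (f s) * M s t * f t) = (\<Sum>s\<in>S. (M s g - M s h) * f s)"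
  proof (intro sum.cong refl)
    fix s
    have "cnj (f s) = f s" by (simp add: f_def)
    then show "(\<Sum>t\<in>S. cnj (f s) * M s t * f t) = (M s g - M s h) * f s"
      unfolding row by (simp add: algebra_simps)
  qed
  also have "\<dots> = (M g g - M g h) - (M h g - M h h)" by (rule row)
  finally have "(M g g - M g h) - (M h g - M h h) \<in> \<real>\<^sub>\<ge>\<^sub>0"
    using assms(1)[unfolded psd_on_def, rule_format, of f] by simp
  then have "0 \<le> Re ((M g g - M g h) - (M h g - M h h))"
    unfolding complex_nonneg_Reals_iff by blast
  then show ?thesis by simp
qed

text \<open>
  For a symmetric weight the off-diagonal entries of \<open>\<rho>\<close> occur in pairs, which are bounded by the
  diagonal ones; what remains is a row sum of the weight times the trace.
\<close>

lemma Re_trace_product_le: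
  fixes w :: "'g \<Rightarrow> 'g \<Rightarrow> real"
  assumes psd: "psd_on G \<rho>" and tr: "trace_on G \<rho> = 1" and fin: "finite G"
    and nn: "\<And>g h. g \<in> G \<Longrightarrow> h \<in> G \<Longrightarrow> 0 \<le> w g h" and sym: "\<And>g h. w g h = w h g"
    and row: "\<And>g. g \<in> G \<Longrightarrow> (\<Sum>h\<in>G. w g h) \<le> C"
  shows "Re (\<Sum>g\<in>G. \<Sum>h\<in>G. complex_of_real (w g h) * \<rho> h g) \<le> C"
proof -
  have diag: "0 \<le> Re (\<rho> g g)" if "g \<in> G" for g
  proof -
    define f :: "'g \<Rightarrow> complex" where "f s = of_bool (s = g)" for s
    have row: "(\<Sum>t\<in>G. k t * f t) = k g" for k
      using that fin by (simp add: f_def)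
    have "(\<Sum>s\<in>G. \<Sum>t\<in>G. cnj (f s) * \<rho> s t * f t) = (\<Sum>s\<in>G. \<rho> s g * f s)"
    proof (intro sum.cong refl)
      fix s
      have "cnj (f s) = f s" by (simp add: f_def)
      then show "(\<Sum>t\<in>G. cnj (f s) * \<rho> s t * f t) = \<rho> s g * f s"
        unfolding row by simp
    qed
    also have "\<dots> = \<rho> g g" by (rule row)
    finally have "(\<Sum>s\<in>G. \<Sum>t\<in>G. cnj (f s) * \<rho> s t * f t) = \<rho> g g" .
    then have "\<rho> g g \<in> \<real>\<^sub>\<ge>\<^sub>0" using psd[unfolded psd_on_def, rule_format, of f] by simp
    then show ?thesis by (auto simp: nonneg_Reals_def)
  qed
  have "Re (\<Sum>g\<in>G. \<Sum>h\<in>G. complex_of_real (w g h) * \<rho> h g) = (\<Sum>g\<in>G. \<Sum>h\<in>G. w g h * Re (\<rho> h g))"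
    by simp
  also have "\<dots> = ((\<Sum>g\<in>G. \<Sum>h\<in>G. w g h * Re (\<rho> h g)) + (\<Sum>g\<in>G. \<Sum>h\<in>G. w g h * Re (\<rho> g h))) / 2"
  proof -
    have "(\<Sum>g\<in>G. \<Sum>h\<in>G. w g h * Re (\<rho> g h)) = (\<Sum>h\<in>G. \<Sum>g\<in>G. w g h * Re (\<rho> g h))"
      by (rule sum.swap)
    also have "\<dots> = (\<Sum>g\<in>G. \<Sum>h\<in>G. w g h * Re (\<rho> h g))" by (simp add: sym)
    finally show ?thesis by simp
  qed
  also have "\<dots> = (\<Sum>g\<in>G. \<Sum>h\<in>G. w g h * (Re (\<rho> h g) + Re (\<rho> g h))) / 2"
    by (simp add: sum.distrib distrib_left)
  also have "\<dots> \<le> (\<Sum>g\<in>G. \<Sum>h\<in>G. w g h * (Re (\<rho> h h) + Re (\<rho> g g))) / 2"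
    using psd_off_diagonal[OF psd fin] nn
    by (intro divide_right_mono sum_mono mult_left_mono) auto
  also have "\<dots> = (\<Sum>g\<in>G. \<Sum>h\<in>G. w g h * Re (\<rho> g g))"
  proof -
    have "(\<Sum>g\<in>G. \<Sum>h\<in>G. w g h * Re (\<rho> h h)) = (\<Sum>h\<in>G. \<Sum>g\<in>G. w g h * Re (\<rho> h h))"
      by (rule sum.swap)
    also have "\<dots> = (\<Sum>g\<in>G. \<Sum>h\<in>G. w g h * Re (\<rho> g g))" by (simp add: sym)
    finally show ?thesis by (simp add: sum.distrib distrib_left)
  qed
  also have "\<dots> = (\<Sum>g\<in>G. (\<Sum>h\<in>G. w g h) * Re (\<rho> g g))" by (simp add: sum_distrib_right)
  also have "\<dots> \<le> (\<Sum>g\<in>G. C * Re (\<rho> g g))"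
    using row diag by (intro sum_mono mult_right_mono) auto
  also have "\<dots> = C * Re (trace_on G \<rho>)" by (simp add: trace_on_def sum_distrib_left)
  finally show ?thesis using tr by simp
qed

text \<open>
  A register held by one party is a lens: \<open>get\<close> reads its basis state off a global basis state and
  \<open>put\<close> overwrites it.
\<close>

definition local_op ::
    "('g \<Rightarrow> 's) \<Rightarrow> ('s \<Rightarrow> 'g \<Rightarrow> 'g) \<Rightarrow> ('s cmat \<Rightarrow> 's cmat) \<Rightarrow> 'g cmat \<Rightarrow> 'g cmat" where
  "local_op get put \<Phi> \<rho> g h = \<Phi> (\<lambda>s t. \<rho> (put s g) (put t h)) (get g) (get h)"

locale subsystem =
  fixes G :: "'g set" and S :: "'s set" and get :: "'g \<Rightarrow> 's" and put :: "'s \<Rightarrow> 'g \<Rightarrow> 'g"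
  assumes finite_whole: "finite G"
    and get_in: "g \<in> G \<Longrightarrow> get g \<in> S"
    and put_in: "s \<in> S \<Longrightarrow> g \<in> G \<Longrightarrow> put s g \<in> G"
    and get_put: "s \<in> S \<Longrightarrow> get (put s g) = s"
    and put_get: "put (get g) g = g"
    and put_put: "put s (put s' g) = put s g"
begin

definition rest :: "'s \<Rightarrow> 'g set" where
  "rest s0 = put s0 ` G"

lemma split_bij:
  assumes "s0 \<in> S"
  shows "bij_betw (\<lambda>g. (get g, put s0 g)) G (S \<times> rest s0)"
    and "bij_betw (\<lambda>(s, r). put s r) (S \<times> rest s0) G"
proof -
  have 1: "\<forall>g\<in>G. (\<lambda>(s, r). put s r) (get g, put s0 g) = g"
    by (simp add: put_put put_get)
  have 2: "\<forall>a\<in>S \<times> rest s0. (\<lambda>g. (get g, put s0 g)) ((\<lambda>(s, r). put s r) a) = a"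
    using assms by (auto simp: rest_def put_put get_put)
  have 3: "(\<lambda>g. (get g, put s0 g)) ` G \<subseteq> S \<times> rest s0"
    using get_in by (auto simp: rest_def)
  have 4: "(\<lambda>(s, r). put s r) ` (S \<times> rest s0) \<subseteq> G"
    using put_in by (auto simp: rest_def put_put)
  show "bij_betw (\<lambda>g. (get g, put s0 g)) G (S \<times> rest s0)"
    using 1 2 3 4 by (rule bij_betw_byWitness)
  show "bij_betw (\<lambda>(s, r). put s r) (S \<times> rest s0) G"
    using 2 1 4 3 by (rule bij_betw_byWitness)
qed

text \<open>
  The remaining registers are represented by the global basis states in which the register
  holds a fixed value \<open>s\<^sub>0\<close>. Numbering these puts the global matrix in the form \<open>S \<times> {..<k}\<close> to
  which complete positivity applies.
\<close>

lemma local_op_psd: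
  assumes op: "quantum_op_on S \<Phi>" and psd: "psd_on G \<rho>"
  shows "psd_on G (local_op get put \<Phi> \<rho>)"
proof (cases "S = {}")
  case True
  then have "G = {}" using get_in by auto
  then show ?thesis by (simp add: psd_on_def)
next
  case False
  then obtain s0 where s0: "s0 \<in> S" by auto
  have "finite (rest s0)" using finite_whole by (simp add: rest_def)
  then obtain idx and k :: nat where idx: "bij_betw idx (rest s0) {..<k}"
    using ex_bij_betw_finite_nat[of "rest s0"] unfolding atLeast0LessThan by blast
  define un where "un = inv_into (rest s0) idx"
  have un: "bij_betw un {..<k} (rest s0)" unfolding un_def using idx by (rule bij_betw_inv_into)
  have un_idx: "un (idx r) = r" if "r \<in> rest s0" for r
    using that idx by (simp add: un_def bij_betw_def)
  define \<mu> where "\<mu> = (\<lambda>(s, r). put s r) \<circ> map_prod id un"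
  define \<pi> where "\<pi> = map_prod id idx \<circ> (\<lambda>g. (get g, put s0 g))"
  have mu: "bij_betw \<mu> (S \<times> {..<k}) G"
    unfolding \<mu>_def by (rule bij_betw_trans[OF bij_betw_map_prod split_bij(2)[OF s0]])
      (simp_all add: un)
  have pi: "bij_betw \<pi> G (S \<times> {..<k})"
    unfolding \<pi>_def by (rule bij_betw_trans[OF split_bij(1)[OF s0] bij_betw_map_prod])
      (simp_all add: idx)
  let ?M = "\<lambda>a b. \<rho> (\<mu> a) (\<mu> b)"
  have fin: "finite (S \<times> {..<k})" using bij_betw_finite[OF mu] finite_whole by simp
  have "psd_on (S \<times> {..<k}) ?M"
    using psd_on_pullback[OF fin finite_whole _ psd, of \<mu> "\<lambda>_. 1"] mu by (simp add: bij_betw_def)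
  then have "psd_on (S \<times> {..<k}) (tensor_id \<Phi> ?M)" using op unfolding quantum_op_on_def by blast
  from psd_on_pullback[OF finite_whole fin _ this, of \<pi> "\<lambda>_. 1"]
  have "psd_on G (\<lambda>g h. tensor_id \<Phi> ?M (\<pi> g) (\<pi> h))" using pi by (simp add: bij_betw_def)
  moreover have "tensor_id \<Phi> ?M (\<pi> g) (\<pi> h) = local_op get put \<Phi> \<rho> g h" if "g \<in> G" "h \<in> G" for g h
  proof -
    have "put s0 g \<in> rest s0" "put s0 h \<in> rest s0" using that by (auto simp: rest_def)
    then show ?thesis
      by (simp add: tensor_id_def \<pi>_def \<mu>_def local_op_def un_idx put_put)
  qed
  ultimately show ?thesis by (simp cong: psd_on_cong)
qed

lemma local_op_trace:
  assumes op: "quantum_op_on S \<Phi>"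
  shows "trace_on G (local_op get put \<Phi> \<rho>) = trace_on G \<rho>"
proof (cases "S = {}")
  case True
  then have "G = {}" using get_in by auto
  then show ?thesis by (simp add: trace_on_def)
next
  case False
  then obtain s0 where s0: "s0 \<in> S" by auto
  have split: "(\<Sum>g\<in>G. k g) = (\<Sum>r\<in>rest s0. \<Sum>s\<in>S. k (put s r))" for k :: "'g \<Rightarrow> complex"
  proof -
    have "(\<Sum>g\<in>G. k g) = (\<Sum>a\<in>S \<times> rest s0. k ((\<lambda>(s, r). put s r) a))"
      by (rule sum.reindex_bij_betw[OF split_bij(2)[OF s0], symmetric])
    also have "\<dots> = (\<Sum>s\<in>S. \<Sum>r\<in>rest s0. k (put s r))"
      by (simp add: sum.cartesian_product')
    also have "\<dots> = (\<Sum>r\<in>rest s0. \<Sum>s\<in>S. k (put s r))" by (rule sum.swap)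
    finally show ?thesis .
  qed
  have "trace_on G (local_op get put \<Phi> \<rho>)
      = (\<Sum>r\<in>rest s0. trace_on S (\<Phi> (\<lambda>s t. \<rho> (put s r) (put t r))))"
    unfolding trace_on_def split
    by (intro sum.cong refl) (simp add: local_op_def put_put get_put)
  also have "\<dots> = (\<Sum>r\<in>rest s0. trace_on S (\<lambda>s t. \<rho> (put s r) (put t r)))"
    using op unfolding quantum_op_on_def by simp
  also have "\<dots> = trace_on G \<rho>" unfolding trace_on_def split ..
  finally show ?thesis .
qed

end

section \<open>Runs of the protocol and boundedness of the cheating probability\<close>

lemma finite_basis_set:
  assumes "\<And>i. i \<in> {1..n} \<Longrightarrow> finite (A i)" "\<And>i. i \<in> {1..n} \<Longrightarrow> finite (B i)"
  shows "finite (basis_set n A B d)"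
  unfolding basis_set_def using assms by (intro finite_cartesian_product finite_PiE) auto

lemma finite_alice_set:
  assumes "\<And>i. i \<in> {1..n} \<Longrightarrow> finite (A i)" "\<And>i. i \<in> {1..n} \<Longrightarrow> finite (B i)" "i \<in> {1..n + 1}"
  shows "finite (alice_set n A B d i)"
  unfolding alice_set_def using assms by (intro finite_cartesian_product finite_PiE) auto

lemma alice_subsystem:
  assumes "\<And>i. i \<in> {1..n} \<Longrightarrow> finite (A i)" "\<And>i. i \<in> {1..n} \<Longrightarrow> finite (B i)" "i \<in> {1..n + 1}"
  shows "subsystem (basis_set n A B d) (alice_set n A B d i) (alice_part n i) (set_alice_part n i)"
proof
  show "finite (basis_set n A B d)" using assms finite_basis_set by blast
  fix g :: "('a, 'b) basis"
  obtain p x y r where g: "g = (p, x, y, r)" by (cases g)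
  show "alice_part n i g \<in> alice_set n A B d i" if "g \<in> basis_set n A B d"
    using that assms(3) unfolding g by (auto simp: basis_set_def alice_set_def PiE_iff)
  show "set_alice_part n i (alice_part n i g) g = g"
    unfolding g by (auto simp: override_on_def)
  fix s :: "('a, 'b) alice_basis"
  obtain p' x' y' where s: "s = (p', x', y')" by (cases s)
  show "set_alice_part n i s g \<in> basis_set n A B d"
    if "s \<in> alice_set n A B d i" "g \<in> basis_set n A B d"
    using that assms(3) unfolding s g
    by (auto simp: basis_set_def alice_set_def PiE_iff override_on_def extensional_def)
  show "alice_part n i (set_alice_part n i s g) = s" if "s \<in> alice_set n A B d i"
    using that unfolding s g
    by (auto simp: alice_set_def override_on_def PiE_iff extensional_def fun_eq_iff)
  fix s' :: "('a, 'b) alice_basis"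
  show "set_alice_part n i s (set_alice_part n i s' g) = set_alice_part n i s g"
    unfolding s g by (cases s') (auto simp: override_on_def fun_eq_iff)
qed

lemma apply_alice_eq_local_op:
  "apply_alice n i = local_op (alice_part n i) (set_alice_part n i)"
  by (simp add: fun_eq_iff apply_alice_def local_op_def)

definition bob_set :: "nat \<Rightarrow> (nat \<Rightarrow> 'b set) \<Rightarrow> (bit \<times> bit \<times> (nat \<Rightarrow> 'b) \<times> (nat \<Rightarrow> 'b)) set" where
  "bob_set n B = {0, 1} \<times> {0, 1} \<times> Pi\<^sub>E {1..n} B \<times> Pi\<^sub>E {1..n} B"

lemma start_bij:
  "bij_betw (\<lambda>g. (alice_part n 1 g, bob_start g)) (basis_set n A B d)
     (alice_set n A B d 1 \<times> bob_set n B)"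
proof (rule bij_betw_byWitness)
  let ?back = "\<lambda>((p, x, y0), b0, b0', y, y'). (p, x, y, (b0, b0', y'))"
  show "\<forall>g\<in>basis_set n A B d. ?back (alice_part n 1 g, bob_start g) = g"
    by (auto simp: basis_set_def PiE_restrict)
  show "\<forall>a\<in>alice_set n A B d 1 \<times> bob_set n B. (alice_part n 1 (?back a), bob_start (?back a)) = a"
    by (auto simp: alice_set_def bob_set_def PiE_restrict)
  show "(\<lambda>g. (alice_part n 1 g, bob_start g)) ` basis_set n A B d \<subseteq> alice_set n A B d 1 \<times> bob_set n B"
  proof (rule image_subsetI)
    fix g assume g: "g \<in> basis_set n A B d"
    obtain p x y b b' y' where eq: "g = (p, x, y, (b, b', y'))" by (metis prod.exhaust)
    show "(alice_part n 1 g, bob_start g) \<in> alice_set n A B d 1 \<times> bob_set n B"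
      using g unfolding eq basis_set_def alice_set_def bob_set_def
      by (auto simp: PiE_iff fun_eq_iff simp del: One_nat_def bit_not_zero_iff bit_not_one_iff)
  qed
  show "?back ` (alice_set n A B d 1 \<times> bob_set n B) \<subseteq> basis_set n A B d"
    by (auto simp: basis_set_def alice_set_def bob_set_def)
qed

lemma phi_state_norm:
  assumes "finite (Pi\<^sub>E {1..n} B)"
    and "prob_vec (Pi\<^sub>E {1..n} B) (\<beta> 0)" "prob_vec (Pi\<^sub>E {1..n} B) (\<beta> 1)"
  shows "(\<Sum>r\<in>bob_set n B. phi_state \<beta> r * cnj (phi_state \<beta> r)) = 1"
proof -
  let ?Y = "Pi\<^sub>E {1..n} B"
  have half: "(\<Sum>y\<in>?Y. \<Sum>y'\<in>?Y. phi_state \<beta> (b, b, y, y') * cnj (phi_state \<beta> (b, b, y, y'))) = 1 / 2"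
    if "prob_vec ?Y (\<beta> b)" for b
  proof -
    have "(\<Sum>y\<in>?Y. \<Sum>y'\<in>?Y. phi_state \<beta> (b, b, y, y') * cnj (phi_state \<beta> (b, b, y, y')))
        = (\<Sum>y\<in>?Y. \<Sum>y'\<in>?Y. if y = y' then complex_of_real (\<beta> b y / 2) else 0)"
    proof (intro sum.cong refl)
      fix y y' assume "y \<in> ?Y"
      then have "0 \<le> \<beta> b y" using that by (simp add: prob_vec_def)
      then have "(1 / sqrt 2 * sqrt (\<beta> b y)) * (1 / sqrt 2 * sqrt (\<beta> b y)) = \<beta> b y / 2" by simp
      then show "phi_state \<beta> (b, b, y, y') * cnj (phi_state \<beta> (b, b, y, y'))
          = (if y = y' then complex_of_real (\<beta> b y / 2) else 0)"
        using \<open>0 \<le> \<beta> b y\<close> by (auto simp: pair_state_def simp flip: of_real_mult of_real_divide)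
    qed
    also have "\<dots> = complex_of_real (sum (\<beta> b) ?Y / 2)"
      using assms(1) by (simp add: sum_divide_distrib)
    also have "sum (\<beta> b) ?Y = 1" using that by (simp only: prob_vec_def)
    finally show ?thesis by simp
  qed
  have off: "phi_state \<beta> (b, b', y, y') = 0" if "b \<noteq> b'" for b b' y y' using that by simp
  have "(\<Sum>r\<in>bob_set n B. phi_state \<beta> r * cnj (phi_state \<beta> r))
      = (\<Sum>b\<in>{0, 1}. \<Sum>b'\<in>{0, 1}. \<Sum>y\<in>?Y. \<Sum>y'\<in>?Y. phi_state \<beta> (b, b', y, y') * cnj (phi_state \<beta> (b, b', y, y')))"
    by (simp only: bob_set_def sum.cartesian_product' split_def fst_conv snd_conv)
  also have "\<dots> = 1"
    by (simp add: half[OF assms(2)] half[OF assms(3)] off del: phi_state.simps One_nat_def)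
  finally show ?thesis .
qed

lemma initial_state_density:
  assumes fin: "finite (basis_set n A B d)" "finite (alice_set n A B d 1)" "finite (Pi\<^sub>E {1..n} B)"
    and \<beta>: "prob_vec (Pi\<^sub>E {1..n} B) (\<beta> 0)" "prob_vec (Pi\<^sub>E {1..n} B) (\<beta> 1)"
    and \<sigma>: "density_on (alice_set n A B d 1) \<sigma>"
  shows "density_on (basis_set n A B d) (initial_state n \<beta> \<sigma>)"
  unfolding density_on_def
proof
  let ?\<pi> = "\<lambda>g. (alice_part n 1 g, bob_start g)"
  let ?k = "\<lambda>(s, r). \<sigma> s s * (phi_state \<beta> r * cnj (phi_state \<beta> r))"
  have "alice_part n 1 ` basis_set n A B d \<subseteq> alice_set n A B d 1"
    using bij_betw_imp_surj_on[OF start_bij[of n A B d]] by (auto simp del: alice_part.simps)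
  from psd_on_pullback[OF fin(1,2) this, of \<sigma> "\<lambda>g. phi_state \<beta> (bob_start g)"] \<sigma>
  show "psd_on (basis_set n A B d) (initial_state n \<beta> \<sigma>)"
    by (simp add: density_on_def initial_state_def[abs_def] mult_ac)
  have "trace_on (basis_set n A B d) (initial_state n \<beta> \<sigma>) = (\<Sum>g\<in>basis_set n A B d. ?k (?\<pi> g))"
    by (simp add: trace_on_def initial_state_def)
  also have "\<dots> = (\<Sum>a\<in>alice_set n A B d 1 \<times> bob_set n B. ?k a)"
    by (rule sum.reindex_bij_betw[OF start_bij])
  also have "\<dots> = (\<Sum>s\<in>alice_set n A B d 1. \<sigma> s s * (\<Sum>r\<in>bob_set n B. phi_state \<beta> r * cnj (phi_state \<beta> r)))"
    by (simp only: sum.cartesian_product' split_def fst_conv snd_conv sum_distrib_left)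
  also have "\<dots> = trace_on (alice_set n A B d 1) \<sigma>"
    unfolding phi_state_norm[where \<beta> = \<beta>, OF fin(3) \<beta>] by (simp add: trace_on_def)
  also have "\<dots> = 1" using \<sigma> by (simp add: density_on_def)
  finally show "trace_on (basis_set n A B d) (initial_state n \<beta> \<sigma>) = 1" .
qed

lemma run_density:
  assumes fin: "\<And>i. i \<in> {1..n} \<Longrightarrow> finite (A i)" "\<And>i. i \<in> {1..n} \<Longrightarrow> finite (B i)"
    and \<beta>: "prob_vec (Pi\<^sub>E {1..n} B) (\<beta> 0)" "prob_vec (Pi\<^sub>E {1..n} B) (\<beta> 1)"
    and \<sigma>: "density_on (alice_set n A B d 1) \<sigma>"
    and ops: "\<And>i. i \<in> {1..n + 1} \<Longrightarrow> quantum_op_on (alice_set n A B d i) (\<Phi> i)"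
  shows "i \<le> n + 1 \<Longrightarrow> density_on (basis_set n A B d) (run n \<beta> \<sigma> \<Phi> i)"
proof (induction i)
  case 0
  have "finite (basis_set n A B d)" using fin by (rule finite_basis_set)
  moreover have "finite (alice_set n A B d 1)" using fin by (intro finite_alice_set) auto
  moreover have "finite (Pi\<^sub>E {1..n} B)" using fin by (intro finite_PiE) auto
  ultimately show ?case unfolding run.simps using \<beta> \<sigma> by (rule initial_state_density)
next
  case (Suc i)
  then have i: "Suc i \<in> {1..n + 1}" by auto
  have sub: "subsystem (basis_set n A B d) (alice_set n A B d (Suc i)) (alice_part n (Suc i)) (set_alice_part n (Suc i))"
    using fin i by (intro alice_subsystem) auto
  show ?case
    using Suc subsystem.local_op_psd[OF sub ops[OF i]] subsystem.local_op_trace[OF sub ops[OF i]]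
    by (simp add: density_on_def apply_alice_eq_local_op)
qed

text \<open>
  The entries of Bob's measurement operator, with the sum over Alice's bit resolved by the
  Kronecker deltas.
\<close>

definition bob_weight :: "(bit \<Rightarrow> (nat \<Rightarrow> 'a) \<Rightarrow> real) \<Rightarrow> bit \<Rightarrow> ('a, 'b) basis \<Rightarrow> ('a, 'b) basis \<Rightarrow> real" where
  "bob_weight \<alpha> c g h = (case (g, h) of
     (((w, a, x'), x, y, (b, b', y')), ((w2, a2, z'), z, y2, (b2, b2', y2'))) \<Rightarrow>
       of_bool (w = w2 \<and> y = y2 \<and> b' = b2' \<and> y' = y2' \<and> a = a2 \<and> b = a + c \<and> b2 = a + c \<and> x = x' \<and> z = z') *
       (sqrt (\<alpha> a x) * sqrt (\<alpha> a z)))"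

lemma bob_measure_eq: "bob_measure \<alpha> c g h = complex_of_real (bob_weight \<alpha> c g h)"
proof -
  obtain w a x' x y b b' y' where g: "g = ((w, a, x'), x, y, (b, b', y'))" by (metis prod.exhaust)
  obtain w2 a2 z' z y2 b2 b2' y2' where h: "h = ((w2, a2, z'), z, y2, (b2, b2', y2'))"
    by (metis prod.exhaust)
  have "a = 0 \<or> a = 1" by (cases a) auto
  then show ?thesis
    by (auto simp: g h bob_weight_def pair_state_def)
qed

text \<open>
  A row of the operator is supported on a single value of Alice's workspace and its entries are at
  most one. Hence the bound does not depend on the dimension of the workspace.
\<close>

lemma bob_weight_row:
  assumes fin: "finite (basis_set n A B 1)" "finite (basis_set n A B d)"
    and \<alpha>: "prob_vec (Pi\<^sub>E {1..n} A) (\<alpha> 0)" "prob_vec (Pi\<^sub>E {1..n} A) (\<alpha> 1)"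
    and finA: "finite (Pi\<^sub>E {1..n} A)" and g: "g \<in> basis_set n A B d"
  shows "(\<Sum>h\<in>basis_set n A B d. bob_weight \<alpha> c g h) \<le> card (basis_set n A B 1)"
    and "h \<in> basis_set n A B d \<Longrightarrow> 0 \<le> bob_weight \<alpha> c g h"
proof -
  have range: "0 \<le> \<alpha> a x" "\<alpha> a x \<le> 1" if "x \<in> Pi\<^sub>E {1..n} A" for a x
  proof -
    have a: "prob_vec (Pi\<^sub>E {1..n} A) (\<alpha> a)" using \<alpha> by (cases a) auto
    then show "0 \<le> \<alpha> a x" using that by (simp add: prob_vec_def)
    have "\<alpha> a x \<le> sum (\<alpha> a) (Pi\<^sub>E {1..n} A)"
      using a that finA by (intro member_le_sum) (auto simp: prob_vec_def)
    then show "\<alpha> a x \<le> 1" using a by (simp add: prob_vec_def)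
  qed
  have entry: "0 \<le> bob_weight \<alpha> c g h \<and> bob_weight \<alpha> c g h \<le> of_bool (fst (fst h) = fst (fst g))"
    if h: "h \<in> basis_set n A B d" for h
  proof -
    obtain w a x' x r where g': "g = ((w, a, x'), x, r)" by (metis prod.exhaust)
    obtain w2 a2 z' z r2 where h': "h = ((w2, a2, z'), z, r2)" by (metis prod.exhaust)
    have xz: "x \<in> Pi\<^sub>E {1..n} A" "z \<in> Pi\<^sub>E {1..n} A" using g h by (auto simp: g' h' basis_set_def)
    have "sqrt (\<alpha> a x) * sqrt (\<alpha> a z) \<le> 1 * 1"
      using range[of x a] range[of z a] xz by (intro mult_mono) auto
    then show ?thesis
      using range[of x a] range[of z a] xz
      by (auto simp: bob_weight_def g' h' split: prod.splits)
  qed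
  then show "h \<in> basis_set n A B d \<Longrightarrow> 0 \<le> bob_weight \<alpha> c g h" by blast
  let ?H = "{h \<in> basis_set n A B d. fst (fst h) = fst (fst g)}"
  have "(\<Sum>h\<in>basis_set n A B d. bob_weight \<alpha> c g h)
      \<le> (\<Sum>h\<in>basis_set n A B d. of_bool (fst (fst h) = fst (fst g)))"
    using entry by (intro sum_mono) blast
  also have "\<dots> = card ?H" using fin by (simp add: Int_def)
  also have "card ?H \<le> card (basis_set n A B 1)"
  proof (rule card_inj_on_le)
    \<comment> \<open>Forgetting the workspace is injective once its basis state is fixed.\<close>
    show "inj_on (\<lambda>((w, q), r). ((0, q), r)) ?H" by (auto simp: inj_on_def)
    show "(\<lambda>((w, q), r). ((0, q), r)) ` ?H \<subseteq> basis_set n A B 1" by (auto simp: basis_set_def)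
  qed (use fin in simp)
  finally show "(\<Sum>h\<in>basis_set n A B d. bob_weight \<alpha> c g h) \<le> card (basis_set n A B 1)" by simp
qed

text \<open>
  What matters is that the constant is independent of the strategy, the workspace included:
  without a common upper bound the supremum defining the cheating probability would be meaningless.
\<close>

lemma bob_prob_bounded:
  assumes fin: "\<And>i. i \<in> {1..n} \<Longrightarrow> finite (A i)" "\<And>i. i \<in> {1..n} \<Longrightarrow> finite (B i)"
    and \<alpha>: "prob_vec (Pi\<^sub>E {1..n} A) (\<alpha> 0)" "prob_vec (Pi\<^sub>E {1..n} A) (\<alpha> 1)"
    and \<beta>: "prob_vec (Pi\<^sub>E {1..n} B) (\<beta> 0)" "prob_vec (Pi\<^sub>E {1..n} B) (\<beta> 1)"
    and \<sigma>: "density_on (alice_set n A B d 1) \<sigma>"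
    and ops: "\<And>i. i \<in> {1..n + 1} \<Longrightarrow> quantum_op_on (alice_set n A B d i) (\<Phi> i)"
  shows "bob_prob n A B \<alpha> \<beta> c d \<sigma> \<Phi> \<le> card (basis_set n A B 1)"
proof -
  let ?G = "basis_set n A B d" and ?\<rho> = "run n \<beta> \<sigma> \<Phi> (n + 1)"
  have fin': "finite (basis_set n A B k)" for k using fin by (rule finite_basis_set)
  have finA: "finite (Pi\<^sub>E {1..n} A)" using fin by (intro finite_PiE) auto
  have dens: "density_on ?G ?\<rho>"
    by (rule run_density[OF fin \<beta> \<sigma> ops]) auto
  have sym: "bob_weight \<alpha> c g h = bob_weight \<alpha> c h g" for g h :: "('a, 'b) basis"
    by (auto simp: bob_weight_def split: prod.splits)
  have "Re (\<Sum>g\<in>?G. \<Sum>h\<in>?G. complex_of_real (bob_weight \<alpha> c g h) * ?\<rho> h g) \<le> card (basis_set n A B 1)"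
    using dens sym bob_weight_row[OF fin' fin' \<alpha> finA]
    by (intro Re_trace_product_le) (auto simp: density_on_def fin')
  then show ?thesis by (simp only: bob_prob_def bob_measure_eq)
qed

lemma P_cheat_alice_ge:
  assumes fin: "\<And>i. i \<in> {1..n} \<Longrightarrow> finite (A i)" "\<And>i. i \<in> {1..n} \<Longrightarrow> finite (B i)"
    and \<alpha>: "prob_vec (Pi\<^sub>E {1..n} A) (\<alpha> 0)" "prob_vec (Pi\<^sub>E {1..n} A) (\<alpha> 1)"
    and \<beta>: "prob_vec (Pi\<^sub>E {1..n} B) (\<beta> 0)" "prob_vec (Pi\<^sub>E {1..n} B) (\<beta> 1)"
    and \<sigma>: "density_on (alice_set n A B d 1) \<sigma>"
    and ops: "\<And>i. i \<in> {1..n + 1} \<Longrightarrow> quantum_op_on (alice_set n A B d i) (\<Phi> i)"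
  shows "bob_prob n A B \<alpha> \<beta> c d \<sigma> \<Phi> \<le> P_cheat_alice n A B \<alpha> \<beta> c"
  unfolding P_cheat_alice_def
proof (rule cSup_upper)
  let ?X = "{bob_prob n A B \<alpha> \<beta> c d \<sigma> \<Phi> | d \<sigma> \<Phi>.
            density_on (alice_set n A B d 1) \<sigma> \<and>
            (\<forall>i\<in>{1..n + 1}. quantum_op_on (alice_set n A B d i) (\<Phi> i))}"
  show "bob_prob n A B \<alpha> \<beta> c d \<sigma> \<Phi> \<in> ?X" using \<sigma> ops by blast
  show "bdd_above ?X"
  proof (rule bdd_aboveI)
    fix x assume "x \<in> ?X"
    then obtain d \<sigma> \<Phi> where x: "x = bob_prob n A B \<alpha> \<beta> c d \<sigma> \<Phi>"
      and *: "density_on (alice_set n A B d 1) \<sigma>"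
        "\<forall>i\<in>{1..n + 1}. quantum_op_on (alice_set n A B d i) (\<Phi> i)" by blast
    show "x \<le> card (basis_set n A B 1)"
      unfolding x using * by (intro bob_prob_bounded[where \<alpha> = \<alpha> and \<beta> = \<beta>, OF fin \<alpha> \<beta>]) auto
  qed
qed

section \<open>Operations that prepare a register afresh\<close>

text \<open>
  Discard a register with basis \<open>R\<close> and prepare it afresh in the pure state with amplitudes \<open>\<tau>\<close>,
  which may depend on the basis state \<open>key s\<close> of a control register; \<open>mk\<close> assembles a basis state
  from those of the two registers. Discarding replaces the construction of a unitary with prescribed
  columns, and no coherence is lost when the discarded register is in a known pure state.
\<close>

definition prepare ::
    "('s \<Rightarrow> 'c) \<Rightarrow> ('c \<Rightarrow> 'r \<Rightarrow> 's) \<Rightarrow> 'r set \<Rightarrow> ('s \<Rightarrow> real) \<Rightarrow> 's cmat \<Rightarrow> 's cmat" where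
  "prepare key mk R \<tau> M s t =
     complex_of_real (\<tau> s * \<tau> t) * (\<Sum>r\<in>R. M (mk (key s) r) (mk (key t) r))"

text \<open>
  For each discarded basis state \<open>r\<close> the map is a pullback of the matrix along
  \<open>s \<mapsto> mk (key s) r\<close>, hence completely positive. The trace is preserved because the new amplitudes
  are normalized for every value of the control register.
\<close>

lemma quantum_op_prepare:
  fixes S :: "'s set"
  assumes fin: "finite S"
    and bij: "bij_betw (\<lambda>(c, r). mk c r) (C \<times> R) S"
    and key: "\<And>c r. c \<in> C \<Longrightarrow> r \<in> R \<Longrightarrow> key (mk c r) = c"
    and norm: "\<And>c. c \<in> C \<Longrightarrow> (\<Sum>r\<in>R. (\<tau> (mk c r))\<^sup>2) = 1"
  shows "quantum_op_on S (prepare key mk R \<tau>)"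
proof -
  have mk_in: "mk (key s) r \<in> S" if "s \<in> S" "r \<in> R" for s r
  proof -
    have "s \<in> (\<lambda>(c, r). mk c r) ` (C \<times> R)"
      using that(1) bij_betw_imp_surj_on[OF bij] by simp
    then obtain c r' where "c \<in> C" "r' \<in> R" "s = mk c r'" by auto
    then show ?thesis using key that(2) bij_betw_imp_surj_on[OF bij] by auto
  qed
  have split: "(\<Sum>s\<in>S. k s) = (\<Sum>c\<in>C. \<Sum>r\<in>R. k (mk c r))" for k :: "'s \<Rightarrow> complex"
  proof -
    have "(\<Sum>s\<in>S. k s) = (\<Sum>a\<in>C \<times> R. k ((\<lambda>(c, r). mk c r) a))"
      by (rule sum.reindex_bij_betw[OF bij, symmetric])
    then show ?thesis by (simp add: sum.cartesian_product')
  qed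
  have trace: "trace_on S (prepare key mk R \<tau> M) = trace_on S M" for M
  proof -
    have "trace_on S (prepare key mk R \<tau> M)
        = (\<Sum>c\<in>C. \<Sum>r\<in>R. complex_of_real ((\<tau> (mk c r))\<^sup>2) * (\<Sum>r'\<in>R. M (mk c r') (mk c r')))"
      unfolding trace_on_def split
      by (intro sum.cong refl) (simp add: prepare_def key power2_eq_square)
    also have "\<dots> = (\<Sum>c\<in>C. complex_of_real (\<Sum>r\<in>R. (\<tau> (mk c r))\<^sup>2) * (\<Sum>r'\<in>R. M (mk c r') (mk c r')))"
      by (simp only: sum_distrib_right[symmetric] of_real_sum)
    also have "\<dots> = trace_on S M" unfolding trace_on_def split using norm by simp
    finally show ?thesis .
  qed
  have cp: "psd_on (S \<times> {..<k}) (tensor_id (prepare key mk R \<tau>) M)"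
    if M: "psd_on (S \<times> {..<k}) M" for k :: nat and M
  proof -
    let ?\<kappa> = "\<lambda>r (s, l). (mk (key s) r, l)"
    let ?t = "\<lambda>(s, l). complex_of_real (\<tau> s)"
    have "psd_on (S \<times> {..<k}) (\<lambda>g h. \<Sum>r\<in>R. ?t g * cnj (?t h) * M (?\<kappa> r g) (?\<kappa> r h))"
      using fin mk_in M by (intro psd_on_sum psd_on_pullback) auto
    moreover have "(\<lambda>g h. \<Sum>r\<in>R. ?t g * cnj (?t h) * M (?\<kappa> r g) (?\<kappa> r h)) = tensor_id (prepare key mk R \<tau>) M"
      by (auto simp: fun_eq_iff tensor_id_def prepare_def sum_distrib_left)
    ultimately show ?thesis by simp
  qed
  have local: "prepare key mk R \<tau> M s t = prepare key mk R \<tau> N s t"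
    if "\<forall>s\<in>S. \<forall>t\<in>S. M s t = N s t" "s \<in> S" "t \<in> S" for M N :: "'s cmat" and s t
    using that mk_in by (simp add: prepare_def)
  show ?thesis
    unfolding quantum_op_on_def
  proof (intro conjI allI impI ballI)
    fix M N :: "'s cmat" and s t assume "\<forall>s\<in>S. \<forall>t\<in>S. M s t = N s t" "s \<in> S" "t \<in> S"
    then show "prepare key mk R \<tau> M s t = prepare key mk R \<tau> N s t" by (rule local)
  next
    fix M N s t
    show "prepare key mk R \<tau> (\<lambda>s t. M s t + N s t) s t = prepare key mk R \<tau> M s t + prepare key mk R \<tau> N s t"
      by (simp add: prepare_def sum.distrib distrib_left)
  next
    fix c M s t
    show "prepare key mk R \<tau> (\<lambda>s t. c * M s t) s t = c * prepare key mk R \<tau> M s t"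
      by (simp add: prepare_def sum_distrib_left mult_ac)
  qed (use trace cp in blast)+
qed

section \<open>A strategy with a single nontrivial operation\<close>

lemma quantum_op_id: "quantum_op_on S (\<lambda>M. M)"
proof -
  have "tensor_id (\<lambda>M. M) M = M" for M :: "('a \<times> nat) cmat"
    by (auto simp: tensor_id_def fun_eq_iff)
  then show ?thesis by (auto simp: quantum_op_on_def)
qed

lemma apply_alice_id: "apply_alice n i (\<lambda>M. M) \<rho> = \<rho>"
proof -
  have "set_alice_part n i (alice_part n i g) g = g" for g :: "('a, 'b) basis"
    by (cases g) (auto simp: override_on_def)
  then show ?thesis by (simp add: fun_eq_iff apply_alice_def)
qed

lemma run_single_op:
  assumes "\<And>i. i \<noteq> j \<Longrightarrow> \<Phi> i = (\<lambda>M. M)" "1 \<le> j"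
  shows "j \<le> m \<Longrightarrow> run n \<beta> \<sigma> \<Phi> m = apply_alice n j (\<Phi> j) (initial_state n \<beta> \<sigma>)"
proof -
  have before: "i < j \<Longrightarrow> run n \<beta> \<sigma> \<Phi> i = initial_state n \<beta> \<sigma>" for i
    by (induction i) (simp_all add: assms(1) apply_alice_id)
  show "j \<le> m \<Longrightarrow> run n \<beta> \<sigma> \<Phi> m = apply_alice n j (\<Phi> j) (initial_state n \<beta> \<sigma>)"
  proof (induction m)
    case 0
    then show ?case using assms(2) by simp
  next
    case (Suc m)
    show ?case
    proof (cases "j = Suc m")
      case True
      then show ?thesis using before[of m] by simp
    next
      case False
      then show ?thesis using Suc by (simp add: assms(1) apply_alice_id)
    qed
  qed
qed

text \<open>
  The amplitudes with which the run of the protocol ends in the strategy below: \<open>q a y x\<close> is the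
  probability that Alice holds \<open>x\<close> and opens to the bit \<open>a\<close>, given that she has received \<open>y\<close>.
\<close>

fun final_amp ::
    "(bit \<Rightarrow> (nat \<Rightarrow> 'b) \<Rightarrow> (nat \<Rightarrow> 'a) \<Rightarrow> real) \<Rightarrow> (bit \<Rightarrow> (nat \<Rightarrow> 'b) \<Rightarrow> real) \<Rightarrow> ('a, 'b) basis \<Rightarrow> real" where
  "final_amp q \<beta> ((w, a, x'), x, y, (b, b', y')) =
     of_bool (x' = x \<and> b' = b \<and> y' = y) * (sqrt (q a y x) * sqrt (\<beta> b y) / sqrt 2)"

text \<open>
  Bob's operator \<open>\<psi>\<^sub>a \<psi>\<^sub>a\<^sup>*\<close> projects, for each \<open>y\<close> separately, the vector with entries
  \<open>\<surd>(q a y x)\<close> on the one with entries \<open>\<surd>(\<alpha> a x)\<close>; the square of the inner product is a fidelity.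
  Requiring \<open>b = a + c\<close> leaves the weight \<open>\<beta> (a + c) y / 2\<close>.
\<close>

lemma bob_prob_pure:
  fixes n A B q \<beta>
  defines "X \<equiv> Pi\<^sub>E {1..n} A" and "Y \<equiv> Pi\<^sub>E {1..n} B"
  assumes fin: "finite (basis_set n A B 1)"
    and \<beta>: "\<And>b y. y \<in> Y \<Longrightarrow> 0 \<le> \<beta> b y"
    and run: "\<And>g h. g \<in> basis_set n A B 1 \<Longrightarrow> h \<in> basis_set n A B 1 \<Longrightarrow>
      run n \<beta> \<sigma> \<Phi> (n + 1) g h = complex_of_real (final_amp q \<beta> g * final_amp q \<beta> h)"
  shows "bob_prob n A B \<alpha> \<beta> c 1 \<sigma> \<Phi>
    = 1 / 2 * (\<Sum>a\<in>{0, 1}. \<Sum>y\<in>Y. \<beta> (a + c) y * fidelity X (q a y) (\<alpha> a))"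
proof -
  let ?G = "basis_set n A B 1"
  define em where "em a y x = (((0, a, x), x, y, (a + c, a + c, y)) :: ('a, 'b) basis)" for a :: bit and y x
  define k where "k g h = bob_weight \<alpha> c g h * (final_amp q \<beta> h * final_amp q \<beta> g)" for g h
  let ?D = "{0, 1 :: bit} \<times> Y \<times> X \<times> X"
  let ?e = "\<lambda>(a, y, x, z). (em a y x, em a y z)"
  have fid: "fidelity X (q a y) (\<alpha> a)
      = (\<Sum>x\<in>X. \<Sum>z\<in>X. (sqrt (q a y x) * sqrt (\<alpha> a x)) * (sqrt (q a y z) * sqrt (\<alpha> a z)))" for a y
    by (simp only: fidelity_def power2_eq_square sum_product)
  have "bob_prob n A B \<alpha> \<beta> c 1 \<sigma> \<Phi> = Re (\<Sum>g\<in>?G. \<Sum>h\<in>?G. complex_of_real (k g h))"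
    unfolding bob_prob_def bob_measure_eq k_def
    by (intro arg_cong[where f = Re] sum.cong refl) (simp only: run of_real_mult)
  also have "\<dots> = (\<Sum>g\<in>?G. \<Sum>h\<in>?G. k g h)" by simp
  also have "\<dots> = (\<Sum>u\<in>?G \<times> ?G. k (fst u) (snd u))"
    by (simp add: sum.cartesian_product')
  also have "\<dots> = (\<Sum>u\<in>?e ` ?D. k (fst u) (snd u))"
  proof (rule sum.mono_neutral_right)
    show "finite (?G \<times> ?G)" using fin by simp
    have bits: "a = 0 \<or> a = 1" for a :: bit by (cases a) auto
    show "?e ` ?D \<subseteq> ?G \<times> ?G" using bits by (auto simp: em_def basis_set_def X_def Y_def)
    show "\<forall>u\<in>?G \<times> ?G - ?e ` ?D. k (fst u) (snd u) = 0"
    proof (rule ballI, rule ccontr)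
      fix u assume u: "u \<in> ?G \<times> ?G - ?e ` ?D" and nz: "k (fst u) (snd u) \<noteq> 0"
      obtain w a x' x y b b' y' w2 a2 z' z y2 b2 b2' y2' where
        eq: "u = (((w, a, x'), x, y, (b, b', y')), ((w2, a2, z'), z, y2, (b2, b2', y2')))"
        by (metis prod.exhaust)
      have "u = ?e (a, y, x, z)"
        using u nz by (auto simp: eq k_def bob_weight_def em_def basis_set_def split: if_splits)
      moreover have "(a, y, x, z) \<in> ?D" using u bits[of a] by (auto simp: eq basis_set_def X_def Y_def)
      ultimately have "u \<in> ?e ` ?D" by (rule image_eqI)
      then show False using u by simp
    qed
  qed
  also have "\<dots> = (\<Sum>v\<in>?D. k (fst (?e v)) (snd (?e v)))"
  proof (subst sum.reindex)
    show "inj_on ?e ?D" by (auto simp: inj_on_def em_def)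
  qed simp
  also have "\<dots> = (\<Sum>(a, y, x, z)\<in>?D. 1 / 2 * (\<beta> (a + c) y *
      ((sqrt (q a y x) * sqrt (\<alpha> a x)) * (sqrt (q a y z) * sqrt (\<alpha> a z)))))"
  proof (intro sum.cong refl)
    fix v assume "v \<in> ?D"
    then obtain a y x z where v: "v = (a, y, x, z)" "y \<in> Y" by auto
    have "sqrt (\<beta> (a + c) y) * sqrt (\<beta> (a + c) y) = \<beta> (a + c) y" using \<beta>[OF v(2)] by simp
    then show "k (fst (?e v)) (snd (?e v)) = (case v of (a, y, x, z) \<Rightarrow> 1 / 2 * (\<beta> (a + c) y *
      ((sqrt (q a y x) * sqrt (\<alpha> a x)) * (sqrt (q a y z) * sqrt (\<alpha> a z)))))"
      by (simp add: v k_def em_def bob_weight_def)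
  qed
  also have "\<dots> = 1 / 2 * (\<Sum>a\<in>{0, 1}. \<Sum>y\<in>Y. \<beta> (a + c) y * fidelity X (q a y) (\<alpha> a))"
    by (simp only: sum.cartesian_product' split_def fst_conv snd_conv sum_distrib_left fid)
  finally show ?thesis .
qed

text \<open>
  The controlled preparation made just before message \<open>j\<close>. The control register consists of Alice's
  copies of the registers \<open>A\<^sub>1, \<dots>, A\<^bsub>j-1\<^esub>\<close> already sent and of the registers
  \<open>B\<^sub>1, \<dots>, B\<^bsub>j-1\<^esub>\<close> received; the fresh register consists of the bit \<open>A\<^sub>0'\<close>, the remaining part of
  \<open>A'\<close>, and the registers \<open>A\<^sub>j, \<dots>, A\<^sub>n\<close> yet to be sent.
\<close>

fun ctrl :: "nat \<Rightarrow> ('a, 'b) alice_basis \<Rightarrow> (nat \<Rightarrow> 'a) \<times> (nat \<Rightarrow> 'b)" where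
  "ctrl j ((w, a, x'), x, y) = (restrict x' {1..<j}, y)"

fun fill :: "nat \<Rightarrow> nat \<Rightarrow> (nat \<Rightarrow> 'a) \<times> (nat \<Rightarrow> 'b) \<Rightarrow> bit \<times> (nat \<Rightarrow> 'a) \<times> (nat \<Rightarrow> 'a) \<Rightarrow> ('a, 'b) alice_basis" where
  "fill n j (u, y) (a, z', z) = ((0, a, override_on u z' {j..n}), z, y)"

text \<open>
  The bit \<open>a\<close> and the remaining components of \<open>x'\<close> are prepared with conditional probability
  \<open>p a y x'\<close>, and these components are copied into the registers to be sent, so that
  Alice keeps the copy \<open>A'\<close> that Bob is going to test.
\<close>

fun new_amp :: "nat \<Rightarrow> nat \<Rightarrow> (bit \<Rightarrow> (nat \<Rightarrow> 'b) \<Rightarrow> (nat \<Rightarrow> 'a) \<Rightarrow> real) \<Rightarrow> ('a, 'b) alice_basis \<Rightarrow> real" where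
  "new_amp n j p ((w, a, x'), x, y) = of_bool (restrict x' {j..n} = x) * sqrt (p a y x')"

definition fresh :: "nat \<Rightarrow> (nat \<Rightarrow> 'a set) \<Rightarrow> nat \<Rightarrow> (bit \<times> (nat \<Rightarrow> 'a) \<times> (nat \<Rightarrow> 'a)) set" where
  "fresh n A j = {0, 1} \<times> Pi\<^sub>E {j..n} A \<times> Pi\<^sub>E {j..n} A"

text \<open>
  Initially the components to be sent in the first \<open>j - 1\<close> messages are distributed according to
  \<open>v\<close> and copied coherently into \<open>A'\<close>; all the others hold the fixed value \<open>z\<^sub>0\<close>.
\<close>

fun init_amp :: "nat \<Rightarrow> nat \<Rightarrow> (nat \<Rightarrow> 'a) \<Rightarrow> ((nat \<Rightarrow> 'a) \<Rightarrow> real) \<Rightarrow> ('a, 'b) alice_basis \<Rightarrow> real" where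
  "init_amp n j z0 v ((w, a, x'), x, y) =
     of_bool (a = 0 \<and> x' = x \<and> restrict x {j..n} = z0) * sqrt (v (restrict x {1..<j}))"

lemma fill_bij:
  assumes "j \<in> {1..n + 1}"
  shows "bij_betw (\<lambda>(c, r). fill n j c r) ((Pi\<^sub>E {1..<j} A \<times> Pi\<^sub>E {1..<j} B) \<times> fresh n A j)
    (alice_set n A B 1 j)"
proof (rule bij_betw_byWitness)
  let ?back = "\<lambda>((w, a, x'), x, y). ((restrict x' {1..<j}, y), (a, restrict x' {j..n}, x))"
  let ?D = "(Pi\<^sub>E {1..<j} A \<times> Pi\<^sub>E {1..<j} B) \<times> fresh n A j"
  show "\<forall>a\<in>?D. ?back ((\<lambda>(c, r). fill n j c r) a) = a"
    by (auto simp: fresh_def override_on_def PiE_iff extensional_def fun_eq_iff simp del: bit_not_zero_iff bit_not_one_iff)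
  show "\<forall>a'\<in>alice_set n A B 1 j. (\<lambda>(c, r). fill n j c r) (?back a') = a'"
    using assms by (auto simp: alice_set_def override_on_def PiE_iff extensional_def fun_eq_iff simp del: bit_not_zero_iff bit_not_one_iff)
  show "(\<lambda>(c, r). fill n j c r) ` ?D \<subseteq> alice_set n A B 1 j"
    using assms by (auto simp: fresh_def alice_set_def override_on_def PiE_iff extensional_def fun_eq_iff simp del: bit_not_zero_iff bit_not_one_iff)
  show "?back ` alice_set n A B 1 j \<subseteq> ?D"
    using assms by (auto simp: fresh_def alice_set_def override_on_def PiE_iff extensional_def fun_eq_iff simp del: bit_not_zero_iff bit_not_one_iff)
qed

lemma restrict_override:
  fixes j n :: nat
  assumes "j \<in> {1..n + 1}" "x \<in> Pi\<^sub>E {1..n} A"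
  shows "override_on (restrict x {1..<j}) (restrict x {j..n}) {j..n} = x"
  using assms by (auto simp: override_on_def PiE_iff extensional_def fun_eq_iff not_le)

lemma restrict_pair_eq_iff:
  fixes j n :: nat
  assumes "j \<in> {1..n + 1}" "x \<in> Pi\<^sub>E {1..n} A" "x' \<in> Pi\<^sub>E {1..n} A"
  shows "restrict x' {1..<j} = restrict x {1..<j} \<and> restrict x' {j..n} = restrict x {j..n} \<longleftrightarrow> x' = x"
  using restrict_override[OF assms(1,2)] restrict_override[OF assms(1,3)] by metis

lemma merge_in:
  fixes j n :: nat
  assumes "j \<in> {1..n + 1}" "u \<in> Pi\<^sub>E {1..<j} A" "z \<in> Pi\<^sub>E {j..n} A"
  shows "override_on u z {j..n} \<in> Pi\<^sub>E {1..n} A"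
    "restrict (override_on u z {j..n}) {1..<j} = u"
    "restrict (override_on u z {j..n}) {j..n} = z"
proof -
  have iv: "i \<in> {1..n} \<longleftrightarrow> i \<in> {1..<j} \<or> i \<in> {j..n}" for i using assms(1) by auto
  show "override_on u z {j..n} \<in> Pi\<^sub>E {1..n} A"
    using assms(2,3) unfolding PiE_iff extensional_def mem_Collect_eq Ball_def iv
    by (auto simp: override_on_def)
  show "restrict (override_on u z {j..n}) {1..<j} = u" "restrict (override_on u z {j..n}) {j..n} = z"
    using assms(2,3) by (auto simp: override_on_def PiE_iff extensional_def fun_eq_iff)
qed

lemma init_amp_density:
  assumes j: "j \<in> {1..n + 1}" and finA: "finite (Pi\<^sub>E {1..n} A)"
    and z0: "z0 \<in> Pi\<^sub>E {j..n} A" and v: "prob_vec (Pi\<^sub>E {1..<j} A) v"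
  defines "\<xi> \<equiv> \<lambda>s :: ('a, 'b) alice_basis. complex_of_real (init_amp n j z0 v s)"
  shows "density_on (alice_set n A B 1 1) (\<lambda>s t. \<xi> s * cnj (\<xi> t))"
proof -
  let ?X = "Pi\<^sub>E {1..n} A" and ?U = "Pi\<^sub>E {1..<j} A"
  let ?m = "\<lambda>u. override_on u z0 {j..n}"
  let ?e = "\<lambda>u. ((0, 0, ?m u), ?m u, \<lambda>_. undefined) :: ('a, 'b) alice_basis"
  have B: "Pi\<^sub>E {1..<1} B = {\<lambda>_. undefined}" by simp
  note m = merge_in[OF j _ z0]
  have "trace_on (alice_set n A B 1 1) (\<lambda>s t. \<xi> s * cnj (\<xi> t))
      = complex_of_real (\<Sum>s\<in>alice_set n A B 1 1. (init_amp n j z0 v s)\<^sup>2)"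
    by (simp add: trace_on_def \<xi>_def power2_eq_square)
  also have "(\<Sum>s\<in>alice_set n A B 1 1. (init_amp n j z0 v s)\<^sup>2) = (\<Sum>s\<in>?e ` ?U. (init_amp n j z0 v s)\<^sup>2)"
  proof (rule sum.mono_neutral_right)
    show "finite (alice_set n A B 1 1)" using finA unfolding alice_set_def B by simp
    show "?e ` ?U \<subseteq> alice_set n A B 1 1" using m(1) unfolding alice_set_def B by auto
    show "\<forall>s\<in>alice_set n A B 1 1 - ?e ` ?U. (init_amp n j z0 v s)\<^sup>2 = 0"
    proof (rule ballI, rule ccontr)
      fix s assume s: "s \<in> alice_set n A B 1 1 - ?e ` ?U" and nz: "(init_amp n j z0 v s)\<^sup>2 \<noteq> 0"
      obtain w a x' x y where eq: "s = ((w, a, x'), x, y)" by (metis prod.exhaust)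
      from s nz have *: "w = 0" "a = 0" "x' = x" "x \<in> ?X" "y = (\<lambda>_. undefined)" "restrict x {j..n} = z0"
        unfolding eq alice_set_def B by (auto split: if_splits)
      have "s = ?e (restrict x {1..<j})" using restrict_override[OF j *(4)] * by (simp add: eq)
      moreover have "restrict x {1..<j} \<in> ?U" using *(4) j by (auto simp: PiE_iff)
      ultimately show False using s by blast
    qed
  qed
  also have "\<dots> = (\<Sum>u\<in>?U. (init_amp n j z0 v (?e u))\<^sup>2)"
  proof (subst sum.reindex)
    show "inj_on ?e ?U"
    proof (rule inj_onI)
      fix u u' assume u: "u \<in> ?U" "u' \<in> ?U" "?e u = ?e u'"
      then have "restrict (?m u) {1..<j} = restrict (?m u') {1..<j}" by simp
      then show "u = u'" unfolding m(2)[OF u(1)] m(2)[OF u(2)] .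
    qed
  qed simp
  also have "\<dots> = sum v ?U" using m v by (intro sum.cong) (auto simp: prob_vec_def)
  also have "\<dots> = 1" using v by (simp add: prob_vec_def)
  finally show ?thesis unfolding density_on_def using psd_on_rank_one by simp
qed

lemma sum_fresh_pick:
  assumes "finite (fresh n A j)" "z0 \<in> Pi\<^sub>E {j..n} A"
  shows "(\<Sum>r\<in>fresh n A j. of_bool (r = (0, z0, z0)) * c) = (c :: complex)"
proof -
  have "(0, z0, z0) \<in> fresh n A j" using assms(2) by (simp add: fresh_def)
  then show ?thesis using assms(1) by (simp flip: sum_distrib_right)
qed

text \<open>
  The register that is discarded before message \<open>j\<close> is still in its initial basis state
  \<open>(0, z\<^sub>0, z\<^sub>0)\<close>, so the sum over its basis reduces to a single term and the state stays pure.
\<close>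

lemma init_amp_fill:
  assumes j: "j \<in> {1..n + 1}" and x: "x \<in> Pi\<^sub>E {1..n} A" and x': "x' \<in> Pi\<^sub>E {1..n} A"
    and r: "(a', z', z) \<in> fresh n A j"
    and g: "g = ((w, a, x'), x, y, r')"
  shows "init_amp n j z0 v (alice_part n 1
      (set_alice_part n j (fill n j (ctrl j (alice_part n j g)) (a', z', z)) g)) =
    of_bool ((a', z', z) = (0, z0, z0)) *
    (of_bool (restrict x' {1..<j} = restrict x {1..<j}) * sqrt (v (restrict x {1..<j})))"
proof -
  let ?u' = "override_on (restrict x' {1..<j}) z' {j..n}" and ?u = "override_on x z {j..n}"
  have z: "z \<in> Pi\<^sub>E {j..n} A" "z' \<in> Pi\<^sub>E {j..n} A" using r by (auto simp: fresh_def)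
  have res: "restrict x {1..<j} \<in> Pi\<^sub>E {1..<j} A" "restrict x' {1..<j} \<in> Pi\<^sub>E {1..<j} A"
    using x x' j by (auto simp: PiE_iff)
  have u: "?u = override_on (restrict x {1..<j}) z {j..n}"
    using j x by (auto simp: override_on_def fun_eq_iff PiE_iff extensional_def not_le)
  note m = merge_in[OF j res(1) z(1), folded u] and m' = merge_in[OF j res(2) z(2)]
  have ru: "restrict ?u {1..n} = ?u" using m(1) by (rule PiE_restrict)
  have "?u' = ?u \<longleftrightarrow> restrict x' {1..<j} = restrict x {1..<j} \<and> z' = z"
    using m m' u by metis
  then show ?thesis
    unfolding g by (auto simp: ru m m' simp del: One_nat_def)
qed

text \<open>
  All bounds on the cheating probability come from this family of strategies. Alice sends
  components distributed according to \<open>v\<close> up to message \<open>j - 1\<close>, and before message \<open>j\<close> she looks at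
  what she has received so far and chooses the remaining components and the bit to which she opens.
  Given \<open>y\<close>, the pair \<open>(a, x)\<close> then has the distribution \<open>v p\<close>.
\<close>

lemma single_op_strategy:
  fixes n :: nat and A :: "nat \<Rightarrow> 'a set" and B :: "nat \<Rightarrow> 'b set"
    and p :: "bit \<Rightarrow> (nat \<Rightarrow> 'b) \<Rightarrow> (nat \<Rightarrow> 'a) \<Rightarrow> real"
  assumes fin: "\<And>i. i \<in> {1..n} \<Longrightarrow> finite (A i)" "\<And>i. i \<in> {1..n} \<Longrightarrow> finite (B i)"
    and \<alpha>: "prob_vec (Pi\<^sub>E {1..n} A) (\<alpha> 0)" "prob_vec (Pi\<^sub>E {1..n} A) (\<alpha> 1)"
    and \<beta>: "prob_vec (Pi\<^sub>E {1..n} B) (\<beta> 0)" "prob_vec (Pi\<^sub>E {1..n} B) (\<beta> 1)"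
    and j: "j \<in> {1..n + 1}" and v: "prob_vec (Pi\<^sub>E {1..<j} A) v"
    and p0: "\<And>a y x. y \<in> Pi\<^sub>E {1..<j} B \<Longrightarrow> x \<in> Pi\<^sub>E {1..n} A \<Longrightarrow> 0 \<le> p a y x"
    and p1: "\<And>y u. y \<in> Pi\<^sub>E {1..<j} B \<Longrightarrow> u \<in> Pi\<^sub>E {1..<j} A \<Longrightarrow>
      (\<Sum>a\<in>{0, 1}. \<Sum>z\<in>Pi\<^sub>E {j..n} A. p a y (override_on u z {j..n})) = 1"
  shows "1 / 2 * (\<Sum>a\<in>{0, 1}. \<Sum>y\<in>Pi\<^sub>E {1..n} B. \<beta> (a + c) y *
      fidelity (Pi\<^sub>E {1..n} A) (\<lambda>x. v (restrict x {1..<j}) * p a (restrict y {1..<j}) x) (\<alpha> a))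
    \<le> P_cheat_alice n A B \<alpha> \<beta> c"
proof -
  let ?X = "Pi\<^sub>E {1..n} A" and ?U = "Pi\<^sub>E {1..<j} A" and ?Z = "Pi\<^sub>E {j..n} A"
  let ?q = "\<lambda>a y x. v (restrict x {1..<j}) * p a (restrict y {1..<j}) x"
  have finX: "finite ?X" and finZ: "finite ?Z" and finG: "finite (basis_set n A B 1)"
    and finS: "finite (alice_set n A B 1 j)"
    using fin j by (auto intro!: finite_PiE finite_basis_set finite_alice_set)
  have "?X \<noteq> {}" using \<alpha>(1) by (auto simp: prob_vec_def)
  then obtain x0 where x0: "x0 \<in> ?X" by auto
  define z0 where "z0 = restrict x0 {j..n}"
  have z0: "z0 \<in> ?Z" using x0 j by (auto simp: z0_def PiE_iff)
  \<comment> \<open>The workspace has dimension one: a copy of the registers sent is kept in \<open>A'\<close> already.\<close>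
  define \<xi> where "\<xi> s = complex_of_real (init_amp n j z0 v s)" for s :: "('a, 'b) alice_basis"
  let ?\<sigma> = "\<lambda>s t. \<xi> s * cnj (\<xi> t)"
  define P where "P = prepare (ctrl j) (fill n j) (fresh n A j) (new_amp n j p :: ('a, 'b) alice_basis \<Rightarrow> real)"
  let ?\<Phi> = "\<lambda>i. if i = j then P else (\<lambda>M. M)"
  have \<sigma>: "density_on (alice_set n A B 1 1) ?\<sigma>"
    unfolding \<xi>_def using j finX z0 v by (rule init_amp_density)
  have "quantum_op_on (alice_set n A B 1 j) P"
    unfolding P_def
  proof (rule quantum_op_prepare[OF finS fill_bij[OF j]])
    fix uy r assume "uy \<in> ?U \<times> Pi\<^sub>E {1..<j} B"
    then obtain u y where uy: "uy = (u, y)" "u \<in> ?U" "y \<in> Pi\<^sub>E {1..<j} B" by auto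
    show "ctrl j (fill n j uy r) = uy" if "r \<in> fresh n A j"
    proof -
      obtain a z' z where r: "r = (a, z', z)" by (metis prod.exhaust)
      then have "z' \<in> ?Z" using that by (simp add: fresh_def)
      then show ?thesis using merge_in(2)[OF j uy(2)] r by (simp add: uy)
    qed
    have "(\<Sum>r\<in>fresh n A j. (new_amp n j p (fill n j uy r))\<^sup>2)
        = (\<Sum>a\<in>{0, 1}. \<Sum>z'\<in>?Z. \<Sum>z\<in>?Z. (new_amp n j p (fill n j uy (a, z', z)))\<^sup>2)"
      by (simp only: fresh_def sum.cartesian_product' split_def fst_conv snd_conv)
    also have "\<dots> = (\<Sum>a\<in>{0, 1}. \<Sum>z'\<in>?Z. \<Sum>z\<in>?Z. of_bool (z' = z) * p a y (override_on u z' {j..n}))"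
    proof (intro sum.cong refl)
      fix a :: bit and z' z assume "z' \<in> ?Z"
      from merge_in[OF j uy(2) this] p0[OF uy(3), of "override_on u z' {j..n}" a]
      show "(new_amp n j p (fill n j uy (a, z', z)))\<^sup>2 = of_bool (z' = z) * p a y (override_on u z' {j..n})"
        by (auto simp: uy(1))
    qed
    also have "\<dots> = (\<Sum>a\<in>{0, 1}. \<Sum>z'\<in>?Z. p a y (override_on u z' {j..n}))"
      using finZ by (intro sum.cong refl) simp
    finally show "(\<Sum>r\<in>fresh n A j. (new_amp n j p (fill n j uy r))\<^sup>2) = 1"
      using p1[OF uy(3,2)] by simp
  qed
  then have ops: "quantum_op_on (alice_set n A B 1 i) (?\<Phi> i)" for i
    by (simp add: quantum_op_id)
  have final: "run n \<beta> ?\<sigma> ?\<Phi> (n + 1) g h = complex_of_real (final_amp ?q \<beta> g * final_amp ?q \<beta> h)"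
    if "g \<in> basis_set n A B 1" "h \<in> basis_set n A B 1" for g h
  proof -
    let ?f = "\<lambda>g r. fill n j (ctrl j (alice_part n j g)) r"
    let ?k = "\<lambda>((w, a, x'), x, y, r). of_bool (restrict x' {1..<j} = restrict x {1..<j}) * sqrt (v (restrict x {1..<j}))
        :: real"
    have amp: "\<xi> (alice_part n 1 (set_alice_part n j (?f g r) g)) = of_bool (r = (0, z0, z0)) * complex_of_real (?k g)"
      and bob: "bob_start (set_alice_part n j (?f g r) g) = bob_start g"
      and fin_amp: "complex_of_real (new_amp n j p (alice_part n j g) * ?k g) * phi_state \<beta> (bob_start g)
        = complex_of_real (final_amp ?q \<beta> g)"
      if g: "g \<in> basis_set n A B 1" and r: "r \<in> fresh n A j" for g r
    proof -
      obtain w a x' x y b b' y' where eq: "g = ((w, a, x'), x, y, (b, b', y'))" by (metis prod.exhaust)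
      obtain a1 z1 z where r': "r = (a1, z1, z)" by (metis prod.exhaust)
      have x: "x \<in> ?X" "x' \<in> ?X" using g by (auto simp: eq basis_set_def)
      show "\<xi> (alice_part n 1 (set_alice_part n j (?f g r) g)) = of_bool (r = (0, z0, z0)) * complex_of_real (?k g)"
        unfolding \<xi>_def r' using init_amp_fill[OF j x r[unfolded r'] eq, of z0 v] by (simp add: eq)
      show "bob_start (set_alice_part n j (?f g r) g) = bob_start g"
        unfolding eq r' by (auto simp: override_on_def fun_eq_iff)
      show "complex_of_real (new_amp n j p (alice_part n j g) * ?k g) * phi_state \<beta> (bob_start g)
        = complex_of_real (final_amp ?q \<beta> g)"
        using restrict_pair_eq_iff[OF j x] unfolding eq
        by (auto simp: pair_state_def real_sqrt_mult)
    qed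
    have r0: "(0, z0, z0) \<in> fresh n A j" using z0 by (simp add: fresh_def)
    have finR: "finite (fresh n A j)" using finZ by (simp add: fresh_def)
    have "run n \<beta> ?\<sigma> ?\<Phi> (n + 1) g h = apply_alice n j P (initial_state n \<beta> ?\<sigma>) g h"
      using j by (subst run_single_op[of j]) auto
    also have "\<dots> = complex_of_real (new_amp n j p (alice_part n j g) * new_amp n j p (alice_part n j h)) *
        (\<Sum>r\<in>fresh n A j. of_bool (r = (0, z0, z0)) *
          (complex_of_real (?k g) * complex_of_real (?k h) * (phi_state \<beta> (bob_start g) * cnj (phi_state \<beta> (bob_start h)))))"
      unfolding apply_alice_def P_def prepare_def
    proof (intro arg_cong2[where f = "(*)"] sum.cong refl)
      fix r assume r: "r \<in> fresh n A j"
      show "initial_state n \<beta> ?\<sigma> (set_alice_part n j (?f g r) g) (set_alice_part n j (?f h r) h)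
        = of_bool (r = (0, z0, z0)) *
          (complex_of_real (?k g) * complex_of_real (?k h) * (phi_state \<beta> (bob_start g) * cnj (phi_state \<beta> (bob_start h))))"
        unfolding initial_state_def amp[OF that(1) r] amp[OF that(2) r] bob[OF that(1) r] bob[OF that(2) r]
        by simp
    qed
    also have "\<dots> = (complex_of_real (new_amp n j p (alice_part n j g) * ?k g) * phi_state \<beta> (bob_start g)) *
        cnj (complex_of_real (new_amp n j p (alice_part n j h) * ?k h) * phi_state \<beta> (bob_start h))"
      unfolding sum_fresh_pick[OF finR z0] by simp
    also have "\<dots> = complex_of_real (final_amp ?q \<beta> g * final_amp ?q \<beta> h)"
      unfolding fin_amp[OF that(1) r0] fin_amp[OF that(2) r0] by simp
    finally show ?thesis .
  qed
  have \<beta>0: "0 \<le> \<beta> b y" if "y \<in> Pi\<^sub>E {1..n} B" for b y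
    using \<beta> that by (cases b) (auto simp: prob_vec_def)
  have "bob_prob n A B \<alpha> \<beta> c 1 ?\<sigma> ?\<Phi> = 1 / 2 * (\<Sum>a\<in>{0, 1}. \<Sum>y\<in>Pi\<^sub>E {1..n} B. \<beta> (a + c) y *
      fidelity ?X (?q a y) (\<alpha> a))"
    by (rule bob_prob_pure[OF finG \<beta>0 final])
  moreover have "bob_prob n A B \<alpha> \<beta> c 1 ?\<sigma> ?\<Phi> \<le> P_cheat_alice n A B \<alpha> \<beta> c"
    by (rule P_cheat_alice_ge[OF fin \<alpha> \<beta> \<sigma> ops])
  ultimately show ?thesis by simp
qed

section \<open>The bounds on the cheating probability\<close>

text \<open>
  The case \<open>j = n + 1\<close>: Alice sends a superposition with distribution \<open>v\<close>, and once she knows all of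
  \<open>y\<close> she only chooses the bit. Her conditional choices for \<open>y\<close> amount to an arbitrary splitting of
  \<open>v\<close>.
\<close>

lemma P_cheat_alice_ge_conc:
  fixes n :: nat and A :: "nat \<Rightarrow> 'a set" and B :: "nat \<Rightarrow> 'b set"
  assumes fin: "\<And>i. i \<in> {1..n} \<Longrightarrow> finite (A i)" "\<And>i. i \<in> {1..n} \<Longrightarrow> finite (B i)"
    and \<alpha>: "prob_vec (Pi\<^sub>E {1..n} A) (\<alpha> 0)" "prob_vec (Pi\<^sub>E {1..n} A) (\<alpha> 1)"
    and \<beta>: "prob_vec (Pi\<^sub>E {1..n} B) (\<beta> 0)" "prob_vec (Pi\<^sub>E {1..n} B) (\<beta> 1)"
    and v: "prob_vec (Pi\<^sub>E {1..n} A) v"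
  shows "(\<Sum>y\<in>Pi\<^sub>E {1..n} B. conc {scaled_fid (Pi\<^sub>E {1..n} A) (\<beta> (0 + c) y) (\<alpha> 0),
      scaled_fid (Pi\<^sub>E {1..n} A) (\<beta> (1 + c) y) (\<alpha> 1)} v) \<le> ereal (2 * P_cheat_alice n A B \<alpha> \<beta> c)"
proof (rule sum_conc_le)
  let ?X = "Pi\<^sub>E {1..n} A" and ?Y = "Pi\<^sub>E {1..n} B"
  show "finite ?Y" using fin by (intro finite_PiE) auto
  show "0 \<le> \<beta> (0 + c) y \<and> 0 \<le> \<beta> (1 + c) y" if "y \<in> ?Y" for y
    using \<beta> that by (cases c) (auto simp: prob_vec_def)
  show "\<forall>x\<in>?X. 0 \<le> \<alpha> 0 x" "\<forall>x\<in>?X. 0 \<le> \<alpha> 1 x" and v0: "\<forall>x\<in>?X. 0 \<le> v x"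
    using \<alpha> v by (auto simp: prob_vec_def)
  fix s assume s: "\<And>y. y \<in> ?Y \<Longrightarrow> s y \<in> splits ?X v"
  \<comment> \<open>Where \<open>v\<close> vanishes, so does every splitting, and \<open>p\<close> only has to be normalized.\<close>
  define p where "p a y x = (if v x = 0 then of_bool (a = 0)
      else (if a = 0 then s y x else v x - s y x) / v x)" for a :: bit and y x
  have ivl: "{1..<n + 1} = {1..n}" "{n + 1..n} = {}" by auto
  have s': "0 \<le> s y x" "s y x \<le> v x" if "y \<in> ?Y" "x \<in> ?X" for y x
    using s[OF that(1)] that(2) by (auto simp: splits_def)
  have "1 / 2 * (\<Sum>a\<in>{0, 1}. \<Sum>y\<in>?Y. \<beta> (a + c) y *
      fidelity ?X (\<lambda>x. v (restrict x {1..<n + 1}) * p a (restrict y {1..<n + 1}) x) (\<alpha> a))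
    \<le> P_cheat_alice n A B \<alpha> \<beta> c"
  proof (rule single_op_strategy[OF fin \<alpha> \<beta>])
    show "n + 1 \<in> {1..n + 1}" by simp
    show "prob_vec (Pi\<^sub>E {1..<n + 1} A) v" using v by (simp only: ivl)
    show "0 \<le> p a y x" if "y \<in> Pi\<^sub>E {1..<n + 1} B" "x \<in> ?X" for a y x
      using s'[of y x] that v0 unfolding ivl by (auto simp: p_def)
    show "(\<Sum>a\<in>{0, 1}. \<Sum>z\<in>Pi\<^sub>E {n + 1..n} A. p a y (override_on u z {n + 1..n})) = 1" for y u
      unfolding ivl by (simp add: p_def flip: add_divide_distrib)
  qed
  moreover have "(\<Sum>a\<in>{0, 1}. \<Sum>y\<in>?Y. \<beta> (a + c) y *
      fidelity ?X (\<lambda>x. v (restrict x {1..<n + 1}) * p a (restrict y {1..<n + 1}) x) (\<alpha> a))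
    = (\<Sum>y\<in>?Y. split_value ?X (\<beta> (0 + c) y) (\<alpha> 0) (\<beta> (1 + c) y) (\<alpha> 1) v (s y))"
  proof -
    have "fidelity ?X (\<lambda>x. v (restrict x {1..<n + 1}) * p a (restrict y {1..<n + 1}) x) (\<alpha> a)
        = fidelity ?X (\<lambda>x. if a = 0 then s y x else v x - s y x) (\<alpha> a)" if y: "y \<in> ?Y" for a y
    proof (rule fidelity_cong)
      fix x assume x: "x \<in> ?X"
      then show "v (restrict x {1..<n + 1}) * p a (restrict y {1..<n + 1}) x
          = (if a = 0 then s y x else v x - s y x)"
        using s'[OF y x] unfolding ivl PiE_restrict[OF x] PiE_restrict[OF y] by (auto simp: p_def)
    qed
    then show ?thesis by (simp add: split_value_def sum.distrib)
  qed
  ultimately show "(\<Sum>y\<in>?Y. split_value ?X (\<beta> (0 + c) y) (\<alpha> 0) (\<beta> (1 + c) y) (\<alpha> 1) v (s y))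
    \<le> 2 * P_cheat_alice n A B \<alpha> \<beta> c" by simp
qed

text \<open>
  The bijection of \<open>S 1 \<times> S 2\<close> with \<open>Pi\<^sub>E {1..2} S\<close> that occurs in the partial trace.
\<close>

definition pair_of :: "'s \<Rightarrow> 's \<Rightarrow> nat \<Rightarrow> 's" where
  "pair_of s1 s2 = (\<lambda>k\<in>{1..2}. if k = 1 then s1 else s2)"

lemma pair_of_in: "s1 \<in> S 1 \<Longrightarrow> s2 \<in> S 2 \<Longrightarrow> pair_of s1 s2 \<in> Pi\<^sub>E {1..2} S"
  by (auto simp: pair_of_def PiE_iff numeral_2_eq_2 le_Suc_eq)

lemma pair_of_apply [simp]: "pair_of s1 s2 1 = s1" "pair_of s1 s2 (Suc 0) = s1" "pair_of s1 s2 2 = s2"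
  by (auto simp: pair_of_def)

lemma sum_pairs:
  "(\<Sum>x\<in>Pi\<^sub>E {1..2} S. f x) = (\<Sum>s1\<in>S 1. \<Sum>s2\<in>S 2. f (pair_of s1 s2))"
proof -
  have "(\<Sum>x\<in>Pi\<^sub>E {1..2} S. f x) = (\<Sum>a\<in>S 1 \<times> S 2. f (pair_of (fst a) (snd a)))"
  proof (rule sum.reindex_bij_witness[where i = "\<lambda>a. pair_of (fst a) (snd a)" and j = "\<lambda>x. (x 1, x 2)"])
    fix x assume x: "x \<in> Pi\<^sub>E {1..2} S"
    show eq: "pair_of (fst (x 1, x 2)) (snd (x 1, x 2)) = x"
    proof
      fix k :: nat
      consider "k = 1" | "k = 2" | "k \<notin> {1..2}" by force
      then show "pair_of (fst (x 1, x 2)) (snd (x 1, x 2)) k = x k"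
        using x by cases (auto simp: pair_of_def PiE_iff extensional_def)
    qed
    show "(x 1, x 2) \<in> S 1 \<times> S 2" using x by (auto simp: PiE_iff)
    show "f (pair_of (fst (x 1, x 2)) (snd (x 1, x 2))) = f x" by (simp only: eq)
  next
    fix a assume "a \<in> S 1 \<times> S 2"
    then show "pair_of (fst a) (snd a) \<in> Pi\<^sub>E {1..2} S" by (intro pair_of_in) auto
  qed auto
  then show ?thesis by (simp add: sum.cartesian_product')
qed

lemma trace2_eq: "trace2 S v s1 = (\<Sum>s2\<in>S 2. v (pair_of s1 s2))"
  by (simp add: trace2_def pair_of_def)

lemma prob_vec_trace2:
  assumes "prob_vec (Pi\<^sub>E {1..2} S) v"
  shows "prob_vec (S 1) (trace2 S v)"
  using assms pair_of_in[of _ S] unfolding prob_vec_def sum_pairs trace2_eq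
  by (auto intro!: sum_nonneg)

lemma sum_singleton_PiE: "(\<Sum>z\<in>Pi\<^sub>E {i} S. f z) = (\<Sum>s\<in>S i. f (\<lambda>k\<in>{i}. s))"
  by (rule sum.reindex_bij_witness[where i = "\<lambda>s. \<lambda>k\<in>{i}. s" and j = "\<lambda>z. z i"])
    (auto simp: PiE_iff extensional_def fun_eq_iff intro!: arg_cong[where f = f])

text \<open>
  The case \<open>j = n = 2\<close>: having received \<open>y\<^sub>1\<close>, Alice opens to the bit \<open>a\<close> for which Bob's bit
  \<open>a + c\<close> makes \<open>y\<^sub>1\<close> more likely, and prepares the second component from the honest conditional distribution of
  \<open>\<alpha> a\<close> given the first. Then the fidelity with \<open>\<alpha> a\<close> is that of the first components. Where the
  marginal vanishes the conditional distribution is immaterial, and a point mass is taken.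
\<close>

lemma P_cheat_alice_ge_two:
  fixes A :: "nat \<Rightarrow> 'a set" and B :: "nat \<Rightarrow> 'b set" and c :: bit
    and \<alpha> :: "bit \<Rightarrow> (nat \<Rightarrow> 'a) \<Rightarrow> real" and \<beta> :: "bit \<Rightarrow> (nat \<Rightarrow> 'b) \<Rightarrow> real"
  assumes fin: "\<And>i. i \<in> {1..2} \<Longrightarrow> finite (A i)" "\<And>i. i \<in> {1..2} \<Longrightarrow> finite (B i)"
    and \<alpha>: "prob_vec (Pi\<^sub>E {1..2} A) (\<alpha> 0)" "prob_vec (Pi\<^sub>E {1..2} A) (\<alpha> 1)"
    and \<beta>: "prob_vec (Pi\<^sub>E {1..2} B) (\<beta> 0)" "prob_vec (Pi\<^sub>E {1..2} B) (\<beta> 1)"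
    and w: "prob_vec (A 1) w"
  defines "t \<equiv> \<lambda>a. trace2 B (\<beta> (a + c))" and "T \<equiv> \<lambda>a. trace2 A (\<alpha> a)"
  shows "1 / 2 * (eta (B 1) (t 0) (t 1) * fidelity (A 1) w (T 0) + tau (B 1) (t 0) (t 1) * fidelity (A 1) w (T 1))
    \<le> P_cheat_alice 2 A B \<alpha> \<beta> c"
proof -
  let ?X = "Pi\<^sub>E {1..2} A" and ?Y = "Pi\<^sub>E {1..2} B"
  define guess where "guess y1 = (if t 0 y1 \<ge> t 1 y1 then 0 else 1 :: bit)" for y1
  have \<alpha>a: "prob_vec ?X (\<alpha> a)" for a using \<alpha> by (cases a) auto
  have \<beta>a: "prob_vec ?Y (\<beta> a)" for a using \<beta> by (cases a) auto
  have Teq: "T a s1 = (\<Sum>s2\<in>A 2. \<alpha> a (pair_of s1 s2))" for a s1 by (simp add: T_def trace2_eq)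
  have teq: "t a s1 = (\<Sum>s2\<in>B 2. \<beta> (a + c) (pair_of s1 s2))" for a s1 by (simp add: t_def trace2_eq)
  have fin2: "finite (A 2)" using fin by simp
  have \<alpha>0: "0 \<le> \<alpha> a (pair_of s1 s2)" if "s1 \<in> A 1" "s2 \<in> A 2" for a s1 s2
    using \<alpha>a[of a] pair_of_in[of s1 A s2] that by (simp add: prob_vec_def)
  have T0: "0 \<le> T a s1" if "s1 \<in> A 1" for a s1
    unfolding Teq using \<alpha>0[OF that] by (intro sum_nonneg) auto
  have "?X \<noteq> {}" using \<alpha>(1) by (auto simp: prob_vec_def)
  then obtain x0 where "x0 \<in> ?X" by auto
  then have x0: "x0 2 \<in> A 2" by auto
  define cond where "cond a x = (if T a (x 1) = 0 then of_bool (x 2 = x0 2) else \<alpha> a x / T a (x 1))"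
    for a and x :: "nat \<Rightarrow> 'a"
  define p where "p a y x = of_bool (a = guess (y 1)) * cond a x" for a and y :: "nat \<Rightarrow> 'b" and x
  have cond1: "(\<Sum>s2\<in>A 2. cond a (pair_of s1 s2)) = 1" for a s1
  proof (cases "T a s1 = 0")
    case True
    then show ?thesis using x0 fin2 by (simp add: cond_def)
  next
    case False
    then show ?thesis by (simp add: cond_def Teq flip: sum_divide_distrib)
  qed
  have ivl: "{1..<2} = {1 :: nat}" "{2..2} = {2 :: nat}" by auto
  have "1 / 2 * (\<Sum>a\<in>{0, 1}. \<Sum>y\<in>?Y. \<beta> (a + c) y *
      fidelity ?X (\<lambda>x. w (restrict x {1..<2} 1) * p a (restrict y {1..<2}) x) (\<alpha> a))
    \<le> P_cheat_alice 2 A B \<alpha> \<beta> c"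
  proof (rule single_op_strategy[OF fin \<alpha> \<beta>])
    show "2 \<in> {1..2 + (1 :: nat)}" by simp
    show "prob_vec (Pi\<^sub>E {1..<2} A) (\<lambda>u. w (u 1))"
      using w unfolding prob_vec_def ivl sum_singleton_PiE by auto
    show "0 \<le> p a y x" if "x \<in> ?X" for a y x
    proof -
      have "x 1 \<in> A 1" "0 \<le> \<alpha> a x" using that \<alpha>a[of a] by (auto simp: prob_vec_def)
      then show ?thesis using T0[of "x 1" a] by (simp add: p_def cond_def)
    qed
    fix y u assume u: "u \<in> Pi\<^sub>E {1..<2} A"
    have ov: "override_on u (\<lambda>k\<in>{2}. s) {2} = pair_of (u 1) s" for s
    proof
      fix k :: nat
      consider "k = 1" | "k = 2" | "k \<notin> {1..2}" by force
      then show "override_on u (\<lambda>k\<in>{2}. s) {2} k = pair_of (u 1) s k"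
        using u by cases (auto simp: pair_of_def override_on_def PiE_iff extensional_def)
    qed
    have "(\<Sum>z\<in>Pi\<^sub>E {2..2} A. p a y (override_on u z {2..2})) = of_bool (a = guess (y 1))" for a
      unfolding ivl sum_singleton_PiE ov p_def by (simp add: cond1 flip: sum_distrib_left)
    then show "(\<Sum>a\<in>{0, 1}. \<Sum>z\<in>Pi\<^sub>E {2..2} A. p a y (override_on u z {2..2})) = 1"
      by (simp add: guess_def)
  qed
  moreover have "fidelity ?X (\<lambda>x. w (restrict x {1..<2} 1) * p a (restrict y {1..<2}) x) (\<alpha> a)
      = of_bool (a = guess (y 1)) * fidelity (A 1) w (T a)" for a y
  proof (cases "a = guess (y 1)")
    case False
    then show ?thesis by (simp add: p_def ivl fidelity_def)
  next
    case True
    have "(\<Sum>s2\<in>A 2. sqrt (cond a (pair_of s1 s2)) * sqrt (\<alpha> a (pair_of s1 s2))) = sqrt (T a s1)"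
      if s1: "s1 \<in> A 1" for s1
    proof (cases "T a s1 = 0")
      case True
      then have "\<forall>s2\<in>A 2. \<alpha> a (pair_of s1 s2) = 0"
        unfolding Teq using \<alpha>0[OF s1] fin2 by (simp add: sum_nonneg_eq_0_iff)
      then show ?thesis using True by simp
    next
      case False
      have "(\<Sum>s2\<in>A 2. sqrt (cond a (pair_of s1 s2)) * sqrt (\<alpha> a (pair_of s1 s2)))
          = (\<Sum>s2\<in>A 2. \<alpha> a (pair_of s1 s2) / sqrt (T a s1))"
        using False \<alpha>0[OF s1] by (intro sum.cong) (auto simp: cond_def real_sqrt_divide)
      also have "\<dots> = T a s1 / sqrt (T a s1)" by (simp add: Teq sum_divide_distrib)
      also have "\<dots> = sqrt (T a s1)" using T0[OF s1] by (simp add: real_div_sqrt)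
      finally show ?thesis .
    qed
    then have "(\<Sum>s1\<in>A 1. sqrt (w s1) *
        (\<Sum>s2\<in>A 2. sqrt (cond a (pair_of s1 s2)) * sqrt (\<alpha> a (pair_of s1 s2))))
      = (\<Sum>s1\<in>A 1. sqrt (w s1) * sqrt (T a s1))" by simp
    moreover have "fidelity ?X (\<lambda>x. w (restrict x {1..<2} 1) * p a (restrict y {1..<2}) x) (\<alpha> a)
      = (\<Sum>s1\<in>A 1. sqrt (w s1) *
        (\<Sum>s2\<in>A 2. sqrt (cond a (pair_of s1 s2)) * sqrt (\<alpha> a (pair_of s1 s2))))\<^sup>2"
      using True unfolding fidelity_def sum_pairs
      by (simp add: p_def ivl real_sqrt_mult sum_distrib_left mult.assoc)
    ultimately show ?thesis using True by (simp add: fidelity_def)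
  qed
  moreover have "(\<Sum>a\<in>{0, 1}. \<Sum>y\<in>?Y. \<beta> (a + c) y * (of_bool (a = guess (y 1)) * fidelity (A 1) w (T a)))
    = eta (B 1) (t 0) (t 1) * fidelity (A 1) w (T 0) + tau (B 1) (t 0) (t 1) * fidelity (A 1) w (T 1)"
  proof -
    have finB: "finite (B 1)" using fin by simp
    have "(\<Sum>y\<in>?Y. \<beta> (a + c) y * (of_bool (a = guess (y 1)) * fidelity (A 1) w (T a)))
      = (\<Sum>y1\<in>B 1. of_bool (a = guess y1) * t a y1) * fidelity (A 1) w (T a)" for a
      unfolding sum_pairs by (simp add: teq sum_distrib_left sum_distrib_right mult_ac)
    moreover have "(\<Sum>y1\<in>B 1. of_bool (0 = guess y1) * t 0 y1) = eta (B 1) (t 0) (t 1)"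
      unfolding eta_def sum.inter_filter[OF finB] by (intro sum.cong) (auto simp: guess_def)
    moreover have "(\<Sum>y1\<in>B 1. of_bool (1 = guess y1) * t 1 y1) = tau (B 1) (t 0) (t 1)"
      unfolding tau_def sum.inter_filter[OF finB] by (intro sum.cong) (auto simp: guess_def)
    ultimately show ?thesis by simp
  qed
  ultimately show ?thesis by simp
qed

text \<open>
  Forcing the outcome \<open>c\<close> means winning when Bob's bit is \<open>a + c\<close>, so both outcomes are covered by
  exchanging the roles of \<open>\<beta> 0\<close> and \<open>\<beta> 1\<close>.
\<close>

lemma conc_chain:
  fixes n :: nat and A :: "nat \<Rightarrow> 'a set" and B :: "nat \<Rightarrow> 'b set" and c :: bit
    and \<alpha> :: "bit \<Rightarrow> (nat \<Rightarrow> 'a) \<Rightarrow> real" and \<beta> :: "bit \<Rightarrow> (nat \<Rightarrow> 'b) \<Rightarrow> real"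
  assumes fin: "\<And>i. i \<in> {1..n} \<Longrightarrow> finite (A i)" "\<And>i. i \<in> {1..n} \<Longrightarrow> finite (B i)"
    and \<alpha>: "prob_vec (Pi\<^sub>E {1..n} A) (\<alpha> 0)" "prob_vec (Pi\<^sub>E {1..n} A) (\<alpha> 1)"
    and \<beta>: "prob_vec (Pi\<^sub>E {1..n} B) (\<beta> 0)" "prob_vec (Pi\<^sub>E {1..n} B) (\<beta> 1)"
  defines "X \<equiv> Pi\<^sub>E {1..n} A" and "Y \<equiv> Pi\<^sub>E {1..n} B"
  defines "M \<equiv> sqrt_matrix (eta Y (\<beta> c) (\<beta> (1 + c))) (\<alpha> 0) (tau Y (\<beta> c) (\<beta> (1 + c))) (\<alpha> 1)"
  defines "K \<equiv> \<lambda>v. ereal (1 / 2) * (\<Sum>y\<in>Y. conc {scaled_fid X (\<beta> (a + c) y) (\<alpha> a) | a. a \<in> {0, 1}} v)"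
  shows "\<exists>v. (\<forall>x\<in>X. 0 \<le> v x) \<and> principal_eigenvector X M (\<lambda>x. sqrt (v x))"
    and "\<And>v. \<forall>x\<in>X. 0 \<le> v x \<Longrightarrow> principal_eigenvector X M (\<lambda>x. sqrt (v x)) \<Longrightarrow>
      K v \<le> ereal (P_cheat_alice n A B \<alpha> \<beta> c) \<and> ereal (1 / 2 * lambda_max X M) \<le> K v"
    and "(1 / 2 + 1 / 2 * sqrt (fidelity X (\<alpha> 0) (\<alpha> 1))) * (1 / 2 + 1 / 2 * trace_dist Y (\<beta> 0) (\<beta> 1))
      \<le> 1 / 2 * lambda_max X M"
proof -
  have finX: "finite X" and finY: "finite Y"
    unfolding X_def Y_def using fin by (auto intro!: finite_PiE)
  have \<alpha>': "prob_vec X (\<alpha> 0)" "prob_vec X (\<alpha> 1)" using \<alpha> by (simp_all add: X_def)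
  have \<beta>': "prob_vec Y (\<beta> a)" for a using \<beta> by (cases a) (auto simp: Y_def)
  show "\<exists>v. (\<forall>x\<in>X. 0 \<le> v x) \<and> principal_eigenvector X M (\<lambda>x. sqrt (v x))"
    unfolding M_def using \<alpha>' finX eta_tau_nonneg[OF \<beta>' \<beta>'] eta_tau_pos[OF finY \<beta>' \<beta>']
    by (intro principal_eigenvector_exists) auto
  have td: "trace_dist Y (\<beta> c) (\<beta> (1 + c)) = trace_dist Y (\<beta> 0) (\<beta> 1)"
    by (cases c) (auto simp: trace_dist_commute)
  show "(1 / 2 + 1 / 2 * sqrt (fidelity X (\<alpha> 0) (\<alpha> 1))) * (1 / 2 + 1 / 2 * trace_dist Y (\<beta> 0) (\<beta> 1))
      \<le> 1 / 2 * lambda_max X M"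
    unfolding M_def td[symmetric] by (rule half_lambda_max_ge[OF finX \<alpha>' finY \<beta>' \<beta>'])
  fix v assume v: "\<forall>x\<in>X. 0 \<le> v x" and pe: "principal_eigenvector X M (\<lambda>x. sqrt (v x))"
  let ?C = "\<Sum>y\<in>Y. conc {scaled_fid X (\<beta> c y) (\<alpha> 0), scaled_fid X (\<beta> (1 + c) y) (\<alpha> 1)} v"
  have K: "K v = ereal (1 / 2) * ?C"
  proof -
    have "{scaled_fid X (\<beta> (a + c) y) (\<alpha> a) | a. a \<in> {0, 1}}
        = {scaled_fid X (\<beta> c y) (\<alpha> 0), scaled_fid X (\<beta> (1 + c) y) (\<alpha> 1)}" for y
      by auto
    then show ?thesis by (simp only: K_def)
  qed
  note pf = principal_eigenvector_fidelity[OF v pe[unfolded M_def]]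
  have "?C \<le> ereal (2 * P_cheat_alice n A B \<alpha> \<beta> c)"
    using P_cheat_alice_ge_conc[OF fin \<alpha> \<beta> pf(1)[unfolded X_def], of c] by (simp only: X_def Y_def add_0)
  then have "K v \<le> ereal (1 / 2) * ereal (2 * P_cheat_alice n A B \<alpha> \<beta> c)"
    unfolding K by (intro ereal_mult_left_mono) auto
  then have 1: "K v \<le> ereal (P_cheat_alice n A B \<alpha> \<beta> c)" by simp
  have "ereal (lambda_max X M) \<le> ?C"
    unfolding M_def pf(2) using finY v by (rule sum_conc_ge)
  then have "ereal (1 / 2) * ereal (lambda_max X M) \<le> K v"
    unfolding K by (intro ereal_mult_left_mono) auto
  then show "K v \<le> ereal (P_cheat_alice n A B \<alpha> \<beta> c) \<and> ereal (1 / 2 * lambda_max X M) \<le> K v"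
    using 1 by simp
qed

lemma six_round_chain:
  fixes A :: "nat \<Rightarrow> 'a set" and B :: "nat \<Rightarrow> 'b set" and c :: bit
    and \<alpha> :: "bit \<Rightarrow> (nat \<Rightarrow> 'a) \<Rightarrow> real" and \<beta> :: "bit \<Rightarrow> (nat \<Rightarrow> 'b) \<Rightarrow> real"
  assumes fin: "\<And>i. i \<in> {1..2} \<Longrightarrow> finite (A i)" "\<And>i. i \<in> {1..2} \<Longrightarrow> finite (B i)"
    and \<alpha>: "prob_vec (Pi\<^sub>E {1..2} A) (\<alpha> 0)" "prob_vec (Pi\<^sub>E {1..2} A) (\<alpha> 1)"
    and \<beta>: "prob_vec (Pi\<^sub>E {1..2} B) (\<beta> 0)" "prob_vec (Pi\<^sub>E {1..2} B) (\<beta> 1)"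
  defines "t \<equiv> \<lambda>a. trace2 B (\<beta> a)" and "T \<equiv> \<lambda>a. trace2 A (\<alpha> a)"
  defines "M \<equiv> sqrt_matrix (eta (B 1) (t c) (t (1 + c))) (T 0) (tau (B 1) (t c) (t (1 + c))) (T 1)"
  shows "1 / 2 * lambda_max (A 1) M \<le> P_cheat_alice 2 A B \<alpha> \<beta> c"
    and "(1 / 2 + 1 / 2 * sqrt (fidelity (A 1) (T 0) (T 1))) * (1 / 2 + 1 / 2 * trace_dist (B 1) (t 0) (t 1))
      \<le> 1 / 2 * lambda_max (A 1) M"
proof -
  have finA: "finite (A 1)" and finB: "finite (B 1)" using fin by auto
  have T: "prob_vec (A 1) (T 0)" "prob_vec (A 1) (T 1)"
    using \<alpha> by (simp_all only: T_def prob_vec_trace2)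
  have t: "prob_vec (B 1) (t a)" for a
    using \<beta> by (cases a) (simp_all only: t_def prob_vec_trace2)
  have td: "trace_dist (B 1) (t c) (t (1 + c)) = trace_dist (B 1) (t 0) (t 1)"
    by (cases c) (auto simp: trace_dist_commute)
  show "(1 / 2 + 1 / 2 * sqrt (fidelity (A 1) (T 0) (T 1))) * (1 / 2 + 1 / 2 * trace_dist (B 1) (t 0) (t 1))
      \<le> 1 / 2 * lambda_max (A 1) M"
    unfolding M_def td[symmetric] by (rule half_lambda_max_ge[OF finA T finB t t])
  obtain w where w: "\<forall>x\<in>A 1. 0 \<le> w x" "principal_eigenvector (A 1) M (\<lambda>x. sqrt (w x))"
    unfolding M_def using principal_eigenvector_exists[OF T eta_tau_nonneg[OF t t] eta_tau_pos[OF finB t t] finA]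
    by blast
  note pf = principal_eigenvector_fidelity[OF w[unfolded M_def]]
  show "1 / 2 * lambda_max (A 1) M \<le> P_cheat_alice 2 A B \<alpha> \<beta> c"
    unfolding M_def pf(2) using P_cheat_alice_ge_two[OF fin \<alpha> \<beta> pf(1), of c]
    by (simp only: t_def T_def add_0)
qed

theorem theorem5p2:
  fixes n :: nat
    and A :: "nat \<Rightarrow> 'a set" and B :: "nat \<Rightarrow> 'b set"
    and \<alpha> :: "bit \<Rightarrow> (nat \<Rightarrow> 'a) \<Rightarrow> real" and \<beta> :: "bit \<Rightarrow> (nat \<Rightarrow> 'b) \<Rightarrow> real"
  assumes "n \<ge> 1"
    and "\<And>i. i \<in> {1..n} \<Longrightarrow> finite (A i)" and "\<And>i. i \<in> {1..n} \<Longrightarrow> finite (B i)"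
    and "prob_vec (Pi\<^sub>E {1..n} A) (\<alpha> 0)" and "prob_vec (Pi\<^sub>E {1..n} A) (\<alpha> 1)"
    and "prob_vec (Pi\<^sub>E {1..n} B) (\<beta> 0)" and "prob_vec (Pi\<^sub>E {1..n} B) (\<beta> 1)"
  shows "(let M = sqrt_matrix (eta (Pi\<^sub>E {1..n} B) (\<beta> 0) (\<beta> 1)) (\<alpha> 0)
                          (tau (Pi\<^sub>E {1..n} B) (\<beta> 0) (\<beta> 1)) (\<alpha> 1)
      in (\<exists>v. (\<forall>x\<in>Pi\<^sub>E {1..n} A. 0 \<le> v x) \<and>
               principal_eigenvector (Pi\<^sub>E {1..n} A) M (\<lambda>x. sqrt (v x))) \<and>
         (\<forall>v. (\<forall>x\<in>Pi\<^sub>E {1..n} A. 0 \<le> v x) \<and>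
               principal_eigenvector (Pi\<^sub>E {1..n} A) M (\<lambda>x. sqrt (v x)) \<longrightarrow>
            ereal (P_cheat_alice n A B \<alpha> \<beta> 0) \<ge>
              ereal (1 / 2) * (\<Sum>y\<in>Pi\<^sub>E {1..n} B.
                 conc {scaled_fid (Pi\<^sub>E {1..n} A) (\<beta> a y) (\<alpha> a) | a. a \<in> {0, 1}} v) \<and>
            ereal (1 / 2) * (\<Sum>y\<in>Pi\<^sub>E {1..n} B.
                 conc {scaled_fid (Pi\<^sub>E {1..n} A) (\<beta> a y) (\<alpha> a) | a. a \<in> {0, 1}} v) \<ge>
              ereal (1 / 2 * lambda_max (Pi\<^sub>E {1..n} A) M)) \<and>
         1 / 2 * lambda_max (Pi\<^sub>E {1..n} A) M \<ge>
           (1 / 2 + 1 / 2 * sqrt (fidelity (Pi\<^sub>E {1..n} A) (\<alpha> 0) (\<alpha> 1))) *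
           (1 / 2 + 1 / 2 * trace_dist (Pi\<^sub>E {1..n} B) (\<beta> 0) (\<beta> 1))) \<and>
     (n = 2 \<longrightarrow>
       (let M = sqrt_matrix
                  (eta (B 1) (trace2 B (\<beta> 0)) (trace2 B (\<beta> 1))) (trace2 A (\<alpha> 0))
                  (tau (B 1) (trace2 B (\<beta> 0)) (trace2 B (\<beta> 1))) (trace2 A (\<alpha> 1))
        in P_cheat_alice n A B \<alpha> \<beta> 0 \<ge> 1 / 2 * lambda_max (A 1) M \<and>
           1 / 2 * lambda_max (A 1) M \<ge>
             (1 / 2 + 1 / 2 * sqrt (fidelity (A 1) (trace2 A (\<alpha> 0)) (trace2 A (\<alpha> 1)))) *
             (1 / 2 + 1 / 2 * trace_dist (B 1) (trace2 B (\<beta> 0)) (trace2 B (\<beta> 1))))) \<and>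
     (let M = sqrt_matrix (eta (Pi\<^sub>E {1..n} B) (\<beta> 1) (\<beta> 0)) (\<alpha> 0)
                          (tau (Pi\<^sub>E {1..n} B) (\<beta> 1) (\<beta> 0)) (\<alpha> 1)
      in (\<exists>v. (\<forall>x\<in>Pi\<^sub>E {1..n} A. 0 \<le> v x) \<and>
               principal_eigenvector (Pi\<^sub>E {1..n} A) M (\<lambda>x. sqrt (v x))) \<and>
         (\<forall>v. (\<forall>x\<in>Pi\<^sub>E {1..n} A. 0 \<le> v x) \<and>
               principal_eigenvector (Pi\<^sub>E {1..n} A) M (\<lambda>x. sqrt (v x)) \<longrightarrow>
            ereal (P_cheat_alice n A B \<alpha> \<beta> 1) \<ge>
              ereal (1 / 2) * (\<Sum>y\<in>Pi\<^sub>E {1..n} B.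
                 conc {scaled_fid (Pi\<^sub>E {1..n} A) (\<beta> (a + 1) y) (\<alpha> a) | a. a \<in> {0, 1}} v) \<and>
            ereal (1 / 2) * (\<Sum>y\<in>Pi\<^sub>E {1..n} B.
                 conc {scaled_fid (Pi\<^sub>E {1..n} A) (\<beta> (a + 1) y) (\<alpha> a) | a. a \<in> {0, 1}} v) \<ge>
              ereal (1 / 2 * lambda_max (Pi\<^sub>E {1..n} A) M)) \<and>
         1 / 2 * lambda_max (Pi\<^sub>E {1..n} A) M \<ge>
           (1 / 2 + 1 / 2 * sqrt (fidelity (Pi\<^sub>E {1..n} A) (\<alpha> 0) (\<alpha> 1))) *
           (1 / 2 + 1 / 2 * trace_dist (Pi\<^sub>E {1..n} B) (\<beta> 0) (\<beta> 1))) \<and>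
     (n = 2 \<longrightarrow>
       (let M = sqrt_matrix
                  (eta (B 1) (trace2 B (\<beta> 1)) (trace2 B (\<beta> 0))) (trace2 A (\<alpha> 0))
                  (tau (B 1) (trace2 B (\<beta> 1)) (trace2 B (\<beta> 0))) (trace2 A (\<alpha> 1))
        in P_cheat_alice n A B \<alpha> \<beta> 1 \<ge> 1 / 2 * lambda_max (A 1) M \<and>
           1 / 2 * lambda_max (A 1) M \<ge>
             (1 / 2 + 1 / 2 * sqrt (fidelity (A 1) (trace2 A (\<alpha> 0)) (trace2 A (\<alpha> 1)))) *
             (1 / 2 + 1 / 2 * trace_dist (B 1) (trace2 B (\<beta> 0)) (trace2 B (\<beta> 1)))))"
proof -
  have xor: "1 + 1 = (0 :: bit)" by simp
  note out0 = conc_chain[OF assms(2-7), where c = 0, unfolded add_0_right]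
    and out1 = conc_chain[OF assms(2-7), where c = 1, unfolded xor]
  have six: "1 / 2 * lambda_max (A 1)
        (sqrt_matrix (eta (B 1) (trace2 B (\<beta> c)) (trace2 B (\<beta> (1 + c)))) (trace2 A (\<alpha> 0))
          (tau (B 1) (trace2 B (\<beta> c)) (trace2 B (\<beta> (1 + c)))) (trace2 A (\<alpha> 1)))
      \<le> P_cheat_alice n A B \<alpha> \<beta> c"
    "(1 / 2 + 1 / 2 * sqrt (fidelity (A 1) (trace2 A (\<alpha> 0)) (trace2 A (\<alpha> 1)))) *
        (1 / 2 + 1 / 2 * trace_dist (B 1) (trace2 B (\<beta> 0)) (trace2 B (\<beta> 1)))
      \<le> 1 / 2 * lambda_max (A 1)
        (sqrt_matrix (eta (B 1) (trace2 B (\<beta> c)) (trace2 B (\<beta> (1 + c)))) (trace2 A (\<alpha> 0))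
          (tau (B 1) (trace2 B (\<beta> c)) (trace2 B (\<beta> (1 + c)))) (trace2 A (\<alpha> 1)))"
    if "n = 2" for c
    using six_round_chain[OF assms(2-7)[unfolded that]] unfolding that by blast+
  note six0 = six[where c = 0, unfolded add_0_right] and six1 = six[where c = 1, unfolded xor]
  show ?thesis
    unfolding Let_def
    by (intro conjI impI allI out0(1,3) out1(1,3) six0 six1
        out0(2)[THEN conjunct1] out0(2)[THEN conjunct2] out1(2)[THEN conjunct1] out1(2)[THEN conjunct2])
      (blast+)
qed

end
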